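(* For $p\in\mathbb{Z}$ and $\theta=p(1-4p^2)$, the set $\mathrm{bAut}_{H_+(\mathbb{Z}[t^{\pm1}])}(\partial(\mathbb{Z}[t^{\pm1}],\theta))$ is infinite.
   Context: $\Lambda=\mathbb{Z}[t^{\pm1}]=\mathbb{Z}[\mathbb{Z}]$ with involution $t\mapsto t^{-1}$. Forms. $M^*=\mathrm{Hom}_\Lambda(M,\Lambda)$ is a left module via the involution; $f^{-*}=(f^* )^{-1}$. Let $Z=\{[t^n]\}\subseteq\widetilde K_1(\Lambda)$. A based module is a stably f.g. free module with a basis class up to changes of basis in $Z$; an isomorphism is simple if its torsion lies in $Z$. For a sign $\epsilon$, $Q_\epsilon(M)=\mathrm{coker}(\phi\mapsto\phi-\epsilon\phi^* )$ on $\mathrm{Hom}(M,M^* )$; an $\epsilon$-quadratic form is a based module $M$ with $\psi\in Q_\epsilon(M)$; isometries are simple isomorphisms preserving $\psi$. $H_\epsilon(L)=(L\oplus L^*,\begin{pmatrix}0&1\\0&0\end{pmatrix})$; $H_+(\Lambda)$ is the case $\epsilon=+1$, $L=\Lambda$. A simple lagrangian is a based summand $L$ of $(M,\psi)$ with $\psi|_L=0$, $L=L^\perp$ and $0\to L\to M\to L^*\to0$ based exact. $(\Lambda,\theta)$ denotes the $(+1)$-quadratic form on $\Lambda$ given by $\theta\in Q_+(\Lambda)=\Lambda/\{x-\overline x\}$. Split formations. A split $(-1)$-quadratic formation $(F,\binom\gamma\delta(G,\theta))$: based modules $F,G$, maps $\gamma\colon G\to F$, $\delta\colon G\to F^*$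 and $\theta\in Q_+(G)$ with $\gamma^*\delta=\theta+\theta^*$ such that $\binom\gamma\delta$ is the inclusion of a simple lagrangian of $H_{-}(F)$. Trivial ones: $(F,F^* )=(F,\binom01(F^*,0))$. An isomorphism $(\alpha,\beta,\nu)$ from index $1$ to index $2$: simple isomorphisms $\alpha\colon F_1\to F_2$, $\beta\colon G_1\to G_2$ and $\nu\in Q_+(F_1^* )$ with $\theta_1+\delta_1^*\nu\delta_1=\beta^*\theta_2\beta\in Q_+(G_1)$, $\alpha\gamma_1+\alpha(\nu+\nu^* )\delta_1=\gamma_2\beta$, $\alpha^{-*}\delta_1=\delta_2\beta$. Composition: $(\alpha',\beta',\nu')\circ(\alpha,\beta,\nu)=(\alpha'\alpha,\beta'\beta,\nu+\alpha^{-1}\nu'\alpha^{-*})$. A stable isomorphism $x\cong_sy$ is an isomorphism $x\oplus(H_1,H_1^* )\to y\oplus(H_2,H_2^* )$, $H_i$ f.g. free based. A homotopy from $(\alpha,\beta,\nu)$ to $(\alpha',\beta',\nu')$ is $\Delta\colon G_1^*\to F_2$ with $\beta'^{-*}-\beta^{-*}=\delta_2^*\Delta$, $\alpha'-\alpha=\Delta\delta_1^*$, $\alpha'\nu'\alpha'^*-\alpha\nu\alpha^*=(-\alpha'\gamma_1+\Delta\theta_1)\Delta^*\in Q_+(F_2^* )$. Isomorphisms $f_i\colon x\oplus u_i\to y\oplus v_i$ ($i=1,2$; $u_i,v_i$ trivial) are stably homotopic if there are based modules $R_i,P,Q$ and isomorphisms $g_i\colon(P,P^* )\to u_i\oplus(R_i,R_i^*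 )$, $h_i\colon v_i\oplus(R_i,R_i^* )\to(Q,Q^* )$ such that the isomorphisms $(\mathrm{id}_y\oplus h_i)(f_i\oplus\mathrm{id})(\mathrm{id}_x\oplus g_i)$ are homotopic. $\mathrm{Iso}(x,y)$ is the set of stable homotopy classes of stable isomorphisms. Boundary automorphisms. For a $(+1)$-quadratic form $v=(V,\theta)$, $\partial v=(V,\binom{1}{\theta+\theta^*}(V,\theta))$; an isometry $h$ has boundary $\partial h=(h,h,0)$. For a stable isomorphism $f=(\alpha,\beta,\nu)\colon\partial v\oplus(P,P^* )\to\partial v\oplus(P',P'^* )$ let $a$ and $s$ be the top left entries of $\alpha$ and of $\alpha\nu\alpha^*\in Q_+(V^*\oplus P'^* )$; the union is $v\cup_f-v=\big(V\oplus V^*,\begin{pmatrix}\theta&0\\ a&-s\end{pmatrix}\big)$. For a form $m$, $\mathrm{bAut}_m(\partial v)$ is the quotient of $\{[f]\in\mathrm{Iso}(\partial v,\partial v):v\cup_f-v\cong m\}$ by the action $(g,h)\cdot[f]=[\partial h\circ f\circ\partial g^{-1}]$ of $\mathrm{Aut}(v)\times\mathrm{Aut}(v)$.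
   Formalization: The formal statement assumes p ≠ 0; for p = 0 the form is θ = 0, every stable automorphism of the boundary is stably homotopic to multiplication by some ±tⁿ, and the set has only one element, so the claim fails there. *)

theory Defs
  imports
    "HOL-Library.Poly_Mapping"
    "Jordan_Normal_Form.Gauss_Jordan_Elimination"
begin

section \<open>The ring and its matrices\<close>

text \<open>\<open>\<Lambda> = \<int>[\<int>] = \<int>[t, t\<^sup>-\<^sup>1]\<close>: finitely supported functions on the additive group of integers,
  with convolution as multiplication.\<close>

type_synonym laurent = "int \<Rightarrow>\<^sub>0 int"

definition tpow :: "int \<Rightarrow> laurent" where
  "tpow n = Poly_Mapping.single n 1"

definition bar :: "laurent \<Rightarrow> laurent" where
  "bar x = Poly_Mapping.map_key uminus x"

text \<open>The conjugate transpose. As \<open>\<Lambda>\<close> is commutative and \<open>M\<^sup>*\<close> is made into a left module by means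
  of the involution, the dual of the linear map \<open>x \<mapsto> A x\<close> has matrix \<open>dagger A\<close> with respect to
  the dual bases, and the identification \<open>M\<^sup>*\<^sup>* = M\<close> becomes an equality.\<close>

definition dagger :: "laurent mat \<Rightarrow> laurent mat" where
  "dagger A = mat (dim_col A) (dim_row A) (\<lambda>(i, j). bar (A $$ (j, i)))"

definition block_sum :: "laurent mat \<Rightarrow> laurent mat \<Rightarrow> laurent mat" where
  "block_sum A B = four_block_mat A (0\<^sub>m (dim_row A) (dim_col B)) (0\<^sub>m (dim_row B) (dim_col A)) B"

inductive_set elementary_group :: "nat \<Rightarrow> laurent mat set" for n :: nat where
  one: "1\<^sub>m n \<in> elementary_group n"
| step: "A \<in> elementary_group n \<Longrightarrow> i < n \<Longrightarrow> j < n \<Longrightarrow> i \<noteq> j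
    \<Longrightarrow> A * addrow_mat n c i j \<in> elementary_group n"

text \<open>\<open>\<Lambda>\<close>'s reduced group \<open>K\<^sub>1\<close> is \<open>GL(\<Lambda>) / E(\<Lambda>)\<close> modulo the class of \<open>-1\<close>. A square matrix
  is invertible with class in the subgroup \<open>Z\<close> of all \<open>[t\<^sup>n]\<close> iff after stabilisation it is an
  elementary matrix times \<open>diag (u t\<^sup>n, 1, \<dots>, 1)\<close> with a sign \<open>u\<close>.\<close>

definition torsion_in_Z :: "laurent mat \<Rightarrow> bool" where
  "torsion_in_Z A \<longleftrightarrow> dim_row A = dim_col A \<and>
    (\<exists>r u n X. u \<in> {1, - 1} \<and> X \<in> elementary_group (dim_row A + r) \<and>
       block_sum A (1\<^sub>m r) = X * multrow_mat (dim_row A + r) 0 (u * tpow n))"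

section \<open>Based modules\<close>

text \<open>A stably f.g. free module with a stable basis is a module \<open>M\<close> with an isomorphism
  \<open>M \<oplus> \<Lambda>\<^sup>k \<cong> \<Lambda>\<^sup>n\<close>. The restriction \<open>C\<close> of this isomorphism to \<open>\<Lambda>\<^sup>k\<close> and the \<open>\<Lambda>\<^sup>k\<close>-component \<open>B\<close> of
  its inverse satisfy \<open>B C = 1\<close>, and \<open>M\<close> is identified with \<open>ker B\<close>, a direct summand of \<open>\<Lambda>\<^sup>n\<close>.
  Conversely every pair with \<open>B C = 1\<close> gives the module \<open>ker B\<close> with the stable basis
  \<open>(x, y) \<mapsto> x + C y\<close>. The pair represents its basis class: two of them give the same class iff
  the identity map is simple, and everything below uses the stable basis only through
  \<open>simple_iso\<close>.\<close>

datatype based_module = Based_Module (retr: "laurent mat") (sect: "laurent mat")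

definition ambient :: "based_module \<Rightarrow> nat" where
  "ambient M = dim_col (retr M)"

definition stab_rank :: "based_module \<Rightarrow> nat" where
  "stab_rank M = dim_row (retr M)"

definition based :: "based_module \<Rightarrow> bool" where
  "based M \<longleftrightarrow> sect M \<in> carrier_mat (ambient M) (stab_rank M) \<and> retr M * sect M = 1\<^sub>m (stab_rank M)"

text \<open>The projection of the ambient free module onto \<open>M\<close>; it plays the role of the identity of \<open>M\<close>.\<close>

definition idm :: "based_module \<Rightarrow> laurent mat" where
  "idm M = 1\<^sub>m (ambient M) - sect M * retr M"

definition elements :: "based_module \<Rightarrow> laurent vec set" where
  "elements M = {x \<in> carrier_vec (ambient M). idm M *\<^sub>v x = x}"

text \<open>A homomorphism \<open>M \<rightarrow> N\<close> is recorded by the matrix of the composite of the ambient projection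
  onto \<open>M\<close>, the homomorphism, and the inclusion of \<open>N\<close>.\<close>

definition homs :: "based_module \<Rightarrow> based_module \<Rightarrow> laurent mat set" where
  "homs M N = {A \<in> carrier_mat (ambient N) (ambient M). idm N * A = A \<and> A * idm M = A}"

definition zero_hom :: "based_module \<Rightarrow> based_module \<Rightarrow> laurent mat" where
  "zero_hom M N = 0\<^sub>m (ambient N) (ambient M)"

definition free_module :: "nat \<Rightarrow> based_module" where
  "free_module n = Based_Module (0\<^sub>m 0 n) (0\<^sub>m n 0)"

definition dual :: "based_module \<Rightarrow> based_module" where
  "dual M = Based_Module (dagger (sect M)) (dagger (retr M))"

definition mod_sum :: "based_module \<Rightarrow> based_module \<Rightarrow> based_module" where
  "mod_sum M N = Based_Module (block_sum (retr M) (retr N)) (block_sum (sect M) (sect N))"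

definition inverse_homs :: "based_module \<Rightarrow> based_module \<Rightarrow> laurent mat \<Rightarrow> laurent mat \<Rightarrow> bool" where
  "inverse_homs M N f g \<longleftrightarrow>
     f \<in> homs M N \<and> g \<in> homs N M \<and> g * f = idm M \<and> f * g = idm N"

definition inv_hom :: "based_module \<Rightarrow> based_module \<Rightarrow> laurent mat \<Rightarrow> laurent mat" where
  "inv_hom M N f = (THE g. inverse_homs M N f g)"

definition module_iso :: "based_module \<Rightarrow> based_module \<Rightarrow> laurent mat \<Rightarrow> bool" where
  "module_iso M N f \<longleftrightarrow> (\<exists>g. inverse_homs M N f g)"

text \<open>For \<open>f : M \<cong> N\<close> with stable bases \<open>M \<oplus> \<Lambda>\<^sup>k \<cong> \<Lambda>\<^sup>m\<close> and \<open>N \<oplus> \<Lambda>\<^sup>l \<cong> \<Lambda>\<^sup>n\<close>, the isomorphism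
  \<open>\<Lambda>\<^sup>m \<oplus> \<Lambda>\<^sup>l \<cong> M \<oplus> \<Lambda>\<^sup>k \<oplus> \<Lambda>\<^sup>l \<cong> N \<oplus> \<Lambda>\<^sup>l \<oplus> \<Lambda>\<^sup>k \<cong> \<Lambda>\<^sup>n \<oplus> \<Lambda>\<^sup>k\<close>
  induced by \<open>f\<close> and the identities of \<open>\<Lambda>\<^sup>k\<close>, \<open>\<Lambda>\<^sup>l\<close> sends \<open>(z, y)\<close> to \<open>(f z + C\<^sub>N y, B\<^sub>M z)\<close>. If \<open>M\<close>
  and \<open>N\<close> are \<open>\<Lambda>\<^sup>m\<close> and \<open>\<Lambda>\<^sup>n\<close> with their standard bases, this is the matrix \<open>f\<close> itself. Permutations
  of summands have torsion represented by a sign and do not matter.\<close>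

definition torsion_matrix :: "based_module \<Rightarrow> based_module \<Rightarrow> laurent mat \<Rightarrow> laurent mat" where
  "torsion_matrix M N f = four_block_mat f (sect N) (retr M) (0\<^sub>m (stab_rank M) (stab_rank N))"

definition simple_iso :: "based_module \<Rightarrow> based_module \<Rightarrow> laurent mat \<Rightarrow> bool" where
  "simple_iso M N f \<longleftrightarrow> module_iso M N f \<and> torsion_in_Z (torsion_matrix M N f)"

definition fg_free :: "based_module \<Rightarrow> bool" where
  "fg_free M \<longleftrightarrow> (\<exists>n f. module_iso M (free_module n) f)"

text \<open>\<open>0 \<rightarrow> L \<rightarrow> M \<rightarrow> N \<rightarrow> 0\<close> is exact, and the isomorphism \<open>L \<oplus> N \<cong> M\<close> given by a splitting
  \<open>s\<close> (whose torsion does not depend on \<open>s\<close>) is simple. Exactness in the middle and injectivity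
  of \<open>j\<close> are part of the isomorphism.\<close>

definition based_exact ::
  "based_module \<Rightarrow> based_module \<Rightarrow> based_module \<Rightarrow> laurent mat \<Rightarrow> laurent mat \<Rightarrow> bool" where
  "based_exact L M N j q \<longleftrightarrow> j \<in> homs L M \<and> q \<in> homs M N \<and> q * j = zero_hom L N \<and>
     (\<exists>s \<in> homs N M. q * s = idm N \<and>
        simple_iso (mod_sum L N) M
          (four_block_mat j s (0\<^sub>m 0 (ambient L)) (0\<^sub>m 0 (ambient N))))"

section \<open>Quadratic forms\<close>

text \<open>Elements of \<open>Q\<^sub>\<epsilon>(M)\<close> are given by representatives in \<open>Hom (M, M\<^sup>*)\<close>; \<open>Q_eq \<epsilon> M \<phi> \<psi>\<close> is equality of
  the classes.\<close>

definition Q_eq :: "int \<Rightarrow> based_module \<Rightarrow> laurent mat \<Rightarrow> laurent mat \<Rightarrow> bool" where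
  "Q_eq \<epsilon> M \<phi> \<psi> \<longleftrightarrow> \<phi> \<in> homs M (dual M) \<and> \<psi> \<in> homs M (dual M) \<and>
     (\<exists>\<chi> \<in> homs M (dual M). \<phi> - \<psi> = \<chi> - of_int \<epsilon> \<cdot>\<^sub>m dagger \<chi>)"

type_synonym quad = "based_module \<times> laurent mat"

definition quadratic_form :: "quad \<Rightarrow> bool" where
  "quadratic_form v \<longleftrightarrow> based (fst v) \<and> snd v \<in> homs (fst v) (dual (fst v))"

definition isometry :: "int \<Rightarrow> quad \<Rightarrow> quad \<Rightarrow> laurent mat \<Rightarrow> bool" where
  "isometry \<epsilon> v w h \<longleftrightarrow> quadratic_form v \<and> quadratic_form w \<and> simple_iso (fst v) (fst w) h \<and>
     Q_eq \<epsilon> (fst v) (dagger h * snd w * h) (snd v)"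

definition isometric :: "int \<Rightarrow> quad \<Rightarrow> quad \<Rightarrow> bool" where
  "isometric \<epsilon> v w \<longleftrightarrow> (\<exists>h. isometry \<epsilon> v w h)"

text \<open>The representative of the hyperbolic form does not depend on \<open>\<epsilon>\<close>, which enters through
  \<open>Q_eq\<close>.\<close>

definition hyperbolic :: "based_module \<Rightarrow> quad" where
  "hyperbolic L = (mod_sum L (dual L),
     four_block_mat (zero_hom L (dual L)) (idm (dual L))
       (zero_hom L L) (zero_hom (dual L) L))"

definition rank_one_form :: "laurent \<Rightarrow> quad" where
  "rank_one_form \<theta> = (free_module 1, mat 1 1 (\<lambda>_. \<theta>))"

definition simple_lagrangian :: "int \<Rightarrow> quad \<Rightarrow> based_module \<Rightarrow> laurent mat \<Rightarrow> bool" where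
  "simple_lagrangian \<epsilon> v L j \<longleftrightarrow>
     (let M = fst v; \<psi> = snd v; q = dagger j * (\<psi> + of_int \<epsilon> \<cdot>\<^sub>m dagger \<psi>)
      in quadratic_form v \<and> based L \<and> j \<in> homs L M \<and> (\<exists>r \<in> homs M L. r * j = idm L) \<and>
         Q_eq \<epsilon> L (dagger j * \<psi> * j) (zero_hom L (dual L)) \<and>
         (\<lambda>x. j *\<^sub>v x) ` elements L = {x \<in> elements M. q *\<^sub>v x = 0\<^sub>v (ambient L)} \<and>
         based_exact L M (dual L) j q)"

section \<open>Split formations\<close>

text \<open>The formation \<open>(F, (\<gamma>, \<delta>) (G, \<theta>))\<close>.\<close>

datatype formation = Formation
  (fF: based_module) (fG: based_module)
  (fgamma: "laurent mat") (fdelta: "laurent mat") (ftheta: "laurent mat")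

definition split_formation :: "formation \<Rightarrow> bool" where
  "split_formation x \<longleftrightarrow> based (fF x) \<and> based (fG x) \<and>
     fgamma x \<in> homs (fG x) (fF x) \<and> fdelta x \<in> homs (fG x) (dual (fF x)) \<and>
     ftheta x \<in> homs (fG x) (dual (fG x)) \<and>
     dagger (fgamma x) * fdelta x = ftheta x + dagger (ftheta x) \<and>
     simple_lagrangian (- 1) (hyperbolic (fF x)) (fG x) (fgamma x @\<^sub>r fdelta x)"

definition trivial_formation :: "based_module \<Rightarrow> formation" where
  "trivial_formation F =
     Formation F (dual F) (zero_hom (dual F) F) (idm (dual F)) (zero_hom (dual F) F)"

definition formation_sum :: "formation \<Rightarrow> formation \<Rightarrow> formation" where
  "formation_sum x y = Formation (mod_sum (fF x) (fF y)) (mod_sum (fG x) (fG y))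
     (block_sum (fgamma x) (fgamma y)) (block_sum (fdelta x) (fdelta y)) (block_sum (ftheta x) (ftheta y))"

text \<open>The triple \<open>(\<alpha>, \<beta>, \<nu>)\<close>, with a representative \<open>\<nu> : F\<^sub>1\<^sup>* \<rightarrow> F\<^sub>1\<close> of the class in
  \<open>Q\<^sub>+(F\<^sub>1\<^sup>*)\<close>. Triples which differ only in this representative are homotopic (by \<open>\<Delta> = 0\<close>).\<close>

type_synonym triple = "laurent mat \<times> laurent mat \<times> laurent mat"

fun formation_iso :: "formation \<Rightarrow> formation \<Rightarrow> triple \<Rightarrow> bool" where
  "formation_iso x y (\<alpha>, \<beta>, \<nu>) \<longleftrightarrow> split_formation x \<and> split_formation y \<and>
     simple_iso (fF x) (fF y) \<alpha> \<and> simple_iso (fG x) (fG y) \<beta> \<and> \<nu> \<in> homs (dual (fF x)) (fF x) \<and>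
     Q_eq 1 (fG x) (ftheta x + dagger (fdelta x) * \<nu> * fdelta x) (dagger \<beta> * ftheta y * \<beta>) \<and>
     \<alpha> * fgamma x + \<alpha> * (\<nu> + dagger \<nu>) * fdelta x = fgamma y * \<beta> \<and>
     dagger (inv_hom (fF x) (fF y) \<alpha>) * fdelta x = fdelta y * \<beta>"

text \<open>\<open>iso_comp x y f' f\<close> is \<open>f' \<circ> f\<close>, where \<open>f : x \<rightarrow> y\<close>.\<close>

fun iso_comp :: "formation \<Rightarrow> formation \<Rightarrow> triple \<Rightarrow> triple \<Rightarrow> triple" where
  "iso_comp x y (\<alpha>', \<beta>', \<nu>') (\<alpha>, \<beta>, \<nu>) =
     (\<alpha>' * \<alpha>, \<beta>' * \<beta>,
      \<nu> + inv_hom (fF x) (fF y) \<alpha> * \<nu>' * dagger (inv_hom (fF x) (fF y) \<alpha>))"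

fun iso_sum :: "triple \<Rightarrow> triple \<Rightarrow> triple" where
  "iso_sum (\<alpha>, \<beta>, \<nu>) (\<alpha>', \<beta>', \<nu>') = (block_sum \<alpha> \<alpha>', block_sum \<beta> \<beta>', block_sum \<nu> \<nu>')"

definition iso_id :: "formation \<Rightarrow> triple" where
  "iso_id x = (idm (fF x), idm (fG x), zero_hom (dual (fF x)) (fF x))"

fun homotopic :: "formation \<Rightarrow> formation \<Rightarrow> triple \<Rightarrow> triple \<Rightarrow> bool" where
  "homotopic x y (\<alpha>, \<beta>, \<nu>) (\<alpha>', \<beta>', \<nu>') \<longleftrightarrow>
     formation_iso x y (\<alpha>, \<beta>, \<nu>) \<and> formation_iso x y (\<alpha>', \<beta>', \<nu>') \<and>
     (\<exists>\<Delta> \<in> homs (dual (fG x)) (fF y).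
        dagger (inv_hom (fG x) (fG y) \<beta>') - dagger (inv_hom (fG x) (fG y) \<beta>)
          = dagger (fdelta y) * \<Delta> \<and>
        \<alpha>' - \<alpha> = \<Delta> * dagger (fdelta x) \<and>
        Q_eq 1 (dual (fF y))
          (\<alpha>' * \<nu>' * dagger \<alpha>' - \<alpha> * \<nu> * dagger \<alpha>)
          ((- (\<alpha>' * fgamma x) + \<Delta> * ftheta x) * dagger \<Delta>))"

text \<open>A stable isomorphism \<open>(P, P', f)\<close> consists of f.g. free based modules and an isomorphism
  \<open>f : x \<oplus> (P, P\<^sup>*) \<rightarrow> y \<oplus> (P', P'\<^sup>*)\<close>.\<close>

type_synonym stable_iso = "based_module \<times> based_module \<times> triple"

definition stable_isos :: "formation \<Rightarrow> formation \<Rightarrow> stable_iso set" where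
  "stable_isos x y = {(P, P', f). based P \<and> based P' \<and> fg_free P \<and> fg_free P' \<and>
     formation_iso (formation_sum x (trivial_formation P)) (formation_sum y (trivial_formation P')) f}"

text \<open>\<open>(id\<^sub>y \<oplus> h) \<circ> (f \<oplus> id) \<circ> (id\<^sub>x \<oplus> g)\<close> for \<open>f : x \<oplus> u \<rightarrow> y \<oplus> v\<close>, \<open>g : w \<rightarrow> u \<oplus> r\<close> and
  \<open>h : v \<oplus> r \<rightarrow> w'\<close>, where \<open>w'\<close> does not enter the formula.\<close>

definition stabilise ::
  "formation \<Rightarrow> formation \<Rightarrow> formation \<Rightarrow> formation \<Rightarrow> formation \<Rightarrow> formation
     \<Rightarrow> triple \<Rightarrow> triple \<Rightarrow> triple \<Rightarrow> triple" where
  "stabilise x y u v r w f g h =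
     iso_comp (formation_sum x w) (formation_sum x (formation_sum u r))
       (iso_comp (formation_sum (formation_sum x u) r) (formation_sum (formation_sum y v) r)
          (iso_sum (iso_id y) h) (iso_sum f (iso_id r)))
       (iso_sum (iso_id x) g)"

fun stably_homotopic :: "formation \<Rightarrow> formation \<Rightarrow> stable_iso \<Rightarrow> stable_iso \<Rightarrow> bool" where
  "stably_homotopic x y (P1, P1', f1) (P2, P2', f2) \<longleftrightarrow>
     (\<exists>R1 R2 P Q g1 g2 h1 h2. based R1 \<and> based R2 \<and> based P \<and> based Q \<and>
        formation_iso (trivial_formation P)
          (formation_sum (trivial_formation P1) (trivial_formation R1)) g1 \<and>
        formation_iso (trivial_formation P)
          (formation_sum (trivial_formation P2) (trivial_formation R2)) g2 \<and>
        formation_iso (formation_sum (trivial_formation P1') (trivial_formation R1))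
          (trivial_formation Q) h1 \<and>
        formation_iso (formation_sum (trivial_formation P2') (trivial_formation R2))
          (trivial_formation Q) h2 \<and>
        homotopic (formation_sum x (trivial_formation P)) (formation_sum y (trivial_formation Q))
          (stabilise x y (trivial_formation P1) (trivial_formation P1') (trivial_formation R1)
             (trivial_formation P) f1 g1 h1)
          (stabilise x y (trivial_formation P2) (trivial_formation P2') (trivial_formation R2)
             (trivial_formation P) f2 g2 h2))"

definition stable_class :: "formation \<Rightarrow> formation \<Rightarrow> stable_iso \<Rightarrow> stable_iso set" where
  "stable_class x y f = {f' \<in> stable_isos x y. stably_homotopic x y f f'}"

definition Iso :: "formation \<Rightarrow> formation \<Rightarrow> stable_iso set set" where
  "Iso x y = stable_class x y ` stable_isos x y"

section \<open>Boundary automorphisms\<close>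

text \<open>All forms here are \<open>+1\<close>-quadratic.\<close>

definition bdry :: "quad \<Rightarrow> formation" where
  "bdry v = Formation (fst v) (fst v) (idm (fst v)) (snd v + dagger (snd v)) (snd v)"

definition bdry_iso :: "quad \<Rightarrow> laurent mat \<Rightarrow> triple" where
  "bdry_iso v h = (h, h, zero_hom (dual (fst v)) (fst v))"

definition Aut :: "quad \<Rightarrow> laurent mat set" where
  "Aut v = {h. isometry 1 v v h}"

definition top_left :: "based_module \<Rightarrow> laurent mat \<Rightarrow> laurent mat" where
  "top_left V A = mat (ambient V) (ambient V) (\<lambda>(i, j). A $$ (i, j))"

fun union_form :: "quad \<Rightarrow> stable_iso \<Rightarrow> quad" where
  "union_form v (P, P', \<alpha>, \<beta>, \<nu>) =
     (let V = fst v; a = top_left V \<alpha>; s = top_left V (\<alpha> * \<nu> * dagger \<alpha>)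
      in (mod_sum V (dual V), four_block_mat (snd v) (zero_hom (dual V) (dual V)) a (- s)))"

text \<open>The representative \<open>\<partial>h \<circ> f \<circ> \<partial>g\<^sup>-\<^sup>1\<close> of \<open>(g, h) \<cdot> [f]\<close>, with \<open>\<partial>h\<close> and \<open>\<partial>g\<^sup>-\<^sup>1\<close> extended by the
  identity of the trivial summands.\<close>

fun act :: "quad \<Rightarrow> laurent mat \<Rightarrow> laurent mat \<Rightarrow> stable_iso \<Rightarrow> stable_iso" where
  "act v g h (P, P', f) =
     (let x = formation_sum (bdry v) (trivial_formation P);
          y = formation_sum (bdry v) (trivial_formation P')
      in (P, P',
          iso_comp x x
            (iso_comp x y (iso_sum (bdry_iso v h) (iso_id (trivial_formation P'))) f)
            (iso_sum (bdry_iso v (inv_hom (fst v) (fst v) g)) (iso_id (trivial_formation P)))))"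

definition bIso :: "quad \<Rightarrow> quad \<Rightarrow> stable_iso set set" where
  "bIso m v = {c \<in> Iso (bdry v) (bdry v). \<exists>f \<in> stable_isos (bdry v) (bdry v).
     c = stable_class (bdry v) (bdry v) f \<and> isometric 1 (union_form v f) m}"

definition bAut :: "quad \<Rightarrow> quad \<Rightarrow> stable_iso set set set" where
  "bAut m v = bIso m v //
     {(stable_class (bdry v) (bdry v) f, stable_class (bdry v) (bdry v) (act v g h f)) | f g h.
        f \<in> stable_isos (bdry v) (bdry v) \<and> g \<in> Aut v \<and> h \<in> Aut v}"

end

theory Submission
  imports Defs "Jordan_Normal_Form.Column_Operations"
begin

text \<open>Write \<open>\<theta> = p (1 - 4 p\<^sup>2)\<close> and \<open>v = (\<Lambda>, \<theta>)\<close>. The idea is to attach to a boundary automorphism its action on the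
cokernel \<open>\<Lambda> / 2\<theta>\<close> of the symmetrised form, and to find infinitely many values of this invariant among
the automorphisms with hyperbolic union.

The invariant. Let \<open>(\<alpha>, \<beta>, \<nu>)\<close> be an isomorphism \<open>\<partial>v \<oplus> (P, P\<^sup>*) \<rightarrow> \<partial>v \<oplus> (P', P'\<^sup>*)\<close>, and consider the top
left entry \<open>a\<close> of \<open>\<alpha>\<close> (the corner). A homotopy changes \<open>\<alpha>\<close> by \<open>\<Delta> \<delta>\<^sup>*\<close> with \<open>\<delta> = diag (2\<theta>, 1)\<close>, and so
changes \<open>a\<close> by a multiple of \<open>2\<theta>\<close> (\<open>homotopic_corner\<close>). Isomorphisms of the trivial summands act by block
diagonal matrices with corner \<open>1\<close> and leave \<open>a\<close> alone (\<open>stabilise_corner\<close>). An isometry of \<open>v\<close> is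
multiplication by a unit \<open>h\<close> such that \<open>h\<close> conjugate times \<open>h\<close> has constant coefficient \<open>1\<close>; this
coefficient is the sum of the squares of the coefficients of \<open>h\<close>, hence \<open>h = \<plusminus>t\<^sup>n\<close> (\<open>norm_one_monomial\<close>).
Therefore the class of \<open>a\<close> in \<open>\<Lambda> / 2\<theta>\<close> up to multiplication by \<open>\<plusminus>t\<^sup>n\<close> depends only on the element of
the set of boundary automorphisms.

The examples. If \<open>a\<close> and \<open>s\<close> satisfy \<open>a bar a + 2\<theta> (s + bar s) = 1\<close>, then there is an automorphism of
\<open>\<partial>v \<oplus> (\<Lambda>, \<Lambda>\<^sup>*)\<close> with corner \<open>a\<close> whose union with \<open>v\<close> has the matrix with rows \<open>(\<theta>, 0)\<close> and \<open>(a, - s)\<close>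
(\<open>bdry_aut_formation_iso\<close>, \<open>union_form_bdry_aut\<close>). That this union is hyperbolic means that \<open>a\<close> and
\<open>- s\<close> are the products \<open>(w', w)\<close> and \<open>(w', w')\<close> for a basis \<open>w, w'\<close> of \<open>H\<^sub>+(\<Lambda>)\<close> with \<open>w\<close> of value \<open>\<theta>\<close>. The
factorisation \<open>\<theta> = p (1 - 2p) (1 + 2p)\<close> allows \<open>w = (1 + 2p t\<^sup>k, p (1 - 2p t\<^sup>k))\<close> for every \<open>k\<close>: the value
of \<open>w\<close> is \<open>\<theta>\<close> up to a difference \<open>x - bar x\<close>, and \<open>w' = (t\<^sup>k, 1 - p t\<^sup>k)\<close> completes it to a
matrix of determinant \<open>1\<close>. This gives \<open>a\<^sub>k = 1 - 4p\<^sup>2 + 2p t\<^sup>k\<close> and \<open>s\<^sub>k = p - t\<^sup>-\<^sup>k\<close>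
(\<open>family_union_hyperbolic\<close>).

The \<open>a\<^sub>k\<close> with \<open>k \<ge> 1\<close> are pairwise inequivalent. Modulo \<open>2\<close> all of them are \<open>1\<close>, so a relation
\<open>a\<^sub>k \<equiv> \<plusminus>t\<^sup>n a\<^sub>l\<close> modulo \<open>2\<theta>\<close> forces \<open>n = 0\<close>; then the coefficient at \<open>t\<^sup>k\<close> forces \<open>k = l\<close>, because
\<open>1 - 4p\<^sup>2\<close> is not a unit of \<open>\<int>\<close> (\<open>family_entries_inequivalent\<close>).

All isomorphisms used are simple because their matrices are products of elementary ones: in the
\<open>2 \<times> 2\<close> case the Euclidean algorithm, applied to the bottom row, terminates in \<open>(0, 1)\<close>.\<close>

section \<open>Laurent polynomials and their involution\<close>

lemma lookup_bar: "Poly_Mapping.lookup (bar x) k = Poly_Mapping.lookup x (- k)"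
  unfolding bar_def by (subst Poly_Mapping.map_key.rep_eq) (simp_all add: inj_def)

lemma bar_add: "bar (x + y) = bar x + bar y"
  by (intro poly_mapping_eqI) (simp add: lookup_bar lookup_add)

lemma bar_uminus: "bar (- x) = - bar x"
  by (intro poly_mapping_eqI) (simp add: lookup_bar)

lemma bar_diff: "bar (x - y) = bar x - bar y"
  by (intro poly_mapping_eqI) (simp add: lookup_bar lookup_minus)

lemma bar_zero: "bar 0 = 0"
  by (intro poly_mapping_eqI) (simp add: lookup_bar)

lemma bar_bar: "bar (bar x) = x"
  by (intro poly_mapping_eqI) (simp add: lookup_bar)

lemma bar_single: "bar (Poly_Mapping.single n c) = Poly_Mapping.single (- n) c"
  by (intro poly_mapping_eqI) (auto simp: lookup_bar lookup_single when_def)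

lemma of_int_laurent: "(of_int c :: laurent) = Poly_Mapping.single 0 c"
  by (intro poly_mapping_eqI) (simp add: lookup_of_int lookup_single)

lemma laurent_expansion: "x = (\<Sum>k\<in>Poly_Mapping.keys x. Poly_Mapping.single k (Poly_Mapping.lookup x k))"
proof (intro poly_mapping_eqI)
  fix n
  have "(\<Sum>k\<in>Poly_Mapping.keys x. Poly_Mapping.lookup x k when k = n) = Poly_Mapping.lookup x n"
  proof (cases "n \<in> Poly_Mapping.keys x")
    case True
    then show ?thesis by (simp add: when_def)
  next
    case False
    then show ?thesis by (simp add: when_def in_keys_iff)
  qed
  then show "Poly_Mapping.lookup x n
      = Poly_Mapping.lookup (\<Sum>k\<in>Poly_Mapping.keys x. Poly_Mapping.single k (Poly_Mapping.lookup x k)) n"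
    by (simp add: lookup_sum lookup_single)
qed

lemma bar_sum: "bar (\<Sum>i\<in>I. f i) = (\<Sum>i\<in>I. bar (f i))"
  by (induction I rule: infinite_finite_induct) (simp_all add: bar_zero bar_add)

lemma bar_mult: "bar (x * y) = bar x * bar y"
proof -
  let ?s = "\<lambda>x k. Poly_Mapping.single k (Poly_Mapping.lookup x k) :: laurent"
  have "bar (x * y) = bar ((\<Sum>k\<in>Poly_Mapping.keys x. ?s x k) * (\<Sum>l\<in>Poly_Mapping.keys y. ?s y l))"
    using laurent_expansion[of x] laurent_expansion[of y] by simp
  also have "\<dots> = bar (\<Sum>k\<in>Poly_Mapping.keys x. ?s x k) * bar (\<Sum>l\<in>Poly_Mapping.keys y. ?s y l)"
    by (simp add: sum_product bar_sum mult_single bar_single add.commute)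
  finally show ?thesis
    using laurent_expansion[of x] laurent_expansion[of y] by simp
qed

lemma bar_of_int: "bar (of_int c) = of_int c"
  by (simp add: of_int_laurent bar_single)

lemma bar_numeral: "bar (numeral c) = numeral c"
  using bar_of_int[of "numeral c"] by simp

lemma bar_one: "bar 1 = 1"
  using bar_of_int[of 1] by simp

lemma bar_power: "bar (x ^ n) = bar x ^ n"
  by (induction n) (simp_all add: bar_mult bar_one)

lemma bar_tpow: "bar (tpow n) = tpow (- n)"
  by (simp add: tpow_def bar_single)

lemmas bar_simps = bar_add bar_diff bar_uminus bar_mult bar_power bar_numeral bar_one bar_zero bar_of_int bar_tpow

lemma tpow_add: "tpow m * tpow n = tpow (m + n)"
  by (simp add: tpow_def mult_single)

lemma tpow_0: "tpow 0 = 1"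
  by (simp add: tpow_def)

lemma tpow_inverse: "tpow k * tpow (- k) = 1"
  by (simp add: tpow_add tpow_0)

lemma lookup_tpow: "Poly_Mapping.lookup (tpow n) j = (1 when j = n)"
  by (simp add: tpow_def lookup_single when_def)

lemma lookup_of_int_mult: "Poly_Mapping.lookup (of_int c * x) k = c * Poly_Mapping.lookup x k"
  for x :: laurent
  by (induction c rule: int_induct[where k = 0]) (simp_all add: algebra_simps lookup_add lookup_minus)

text \<open>The constant coefficient of \<open>bar x * x\<close> is a positive definite quadratic form in the coefficients
of \<open>x\<close>. This positivity is what makes the isometry group of a rank one form small.\<close>

lemma lookup_bar_mult_0:
  "Poly_Mapping.lookup (bar x * x) 0 = (\<Sum>k\<in>Poly_Mapping.keys x. (Poly_Mapping.lookup x k)\<^sup>2)"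
proof -
  let ?s = "\<lambda>x k. Poly_Mapping.single k (Poly_Mapping.lookup x k) :: laurent"
  have "bar x * x = bar (\<Sum>k\<in>Poly_Mapping.keys x. ?s x k) * (\<Sum>l\<in>Poly_Mapping.keys x. ?s x l)"
    using laurent_expansion[of x] by simp
  also have "\<dots> = (\<Sum>k\<in>Poly_Mapping.keys x. \<Sum>l\<in>Poly_Mapping.keys x.
      Poly_Mapping.single (l - k) (Poly_Mapping.lookup x k * Poly_Mapping.lookup x l))"
    by (simp add: sum_product bar_sum mult_single bar_single)
  finally show ?thesis
    by (simp add: lookup_sum lookup_single when_def power2_eq_square)
qed

text \<open>Elements of the form \<open>y - bar y\<close> have constant coefficient \<open>0\<close>. So the sum of the squares of
the coefficients of \<open>x\<close> is \<open>1\<close>, and integrality leaves only one nonzero coefficient.\<close>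

lemma norm_one_monomial:
  assumes "c \<noteq> 0" "bar x * of_int c * x - of_int c = y - bar y"
  shows "\<exists>u n. u \<in> {1, - 1} \<and> x = of_int u * tpow n"
proof -
  let ?S = "Poly_Mapping.keys x" and ?l = "Poly_Mapping.lookup x"
  have "Poly_Mapping.lookup (bar x * of_int c * x - of_int c) 0 = 0"
    unfolding assms(2) by (simp add: lookup_minus lookup_bar)
  moreover have "bar x * of_int c * x = of_int c * (bar x * x)"
    by (simp add: ac_simps)
  ultimately have "c * (\<Sum>k\<in>?S. (?l k)\<^sup>2) = c"
    by (simp add: lookup_minus lookup_of_int_mult lookup_bar_mult_0 lookup_of_int)
  then have sum: "(\<Sum>k\<in>?S. (?l k)\<^sup>2) = 1"
    using assms(1) by simp
  have ge: "(?l k)\<^sup>2 \<ge> 1" if "k \<in> ?S" for k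
    using that by (simp add: in_keys_iff int_one_le_iff_zero_less)
  have "int (card ?S) \<le> (\<Sum>k\<in>?S. (?l k)\<^sup>2)"
    using sum_mono[of ?S "\<lambda>_. 1" "\<lambda>k. (?l k)\<^sup>2"] ge by simp
  moreover have "?S \<noteq> {}"
    using sum by auto
  ultimately have "card ?S = 1"
    using sum by (simp add: le_Suc_eq)
  then obtain n where n: "?S = {n}"
    by (auto simp: card_1_singleton_iff)
  then have "(?l n)\<^sup>2 = 1"
    using sum by simp
  then have u: "?l n \<in> {1, - 1}"
    by (simp add: power2_eq_1_iff)
  have "x = Poly_Mapping.single n (?l n)"
    using laurent_expansion[of x] n by simp
  also have "\<dots> = of_int (?l n) * tpow n"
    by (simp add: of_int_laurent tpow_def mult_single)
  finally show ?thesis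
    using u by blast
qed

section \<open>Conjugate transposes and small matrices\<close>

lemma dagger_carrier: "A \<in> carrier_mat m n \<Longrightarrow> dagger A \<in> carrier_mat n m"
  by (auto simp: dagger_def)

lemma dagger_dagger: "dagger (dagger A) = A"
  by (intro eq_matI) (auto simp: dagger_def bar_bar)

lemma dagger_zero: "dagger (0\<^sub>m m n) = 0\<^sub>m n m"
  by (intro eq_matI) (auto simp: dagger_def bar_zero)

lemma dagger_one: "dagger (1\<^sub>m n) = 1\<^sub>m n"
  by (intro eq_matI) (auto simp: dagger_def bar_one bar_zero)

lemma dagger_add: "A \<in> carrier_mat m n \<Longrightarrow> B \<in> carrier_mat m n \<Longrightarrow> dagger (A + B) = dagger A + dagger B"
  by (intro eq_matI) (auto simp: dagger_def bar_add)

lemma dagger_mult: "A \<in> carrier_mat m n \<Longrightarrow> B \<in> carrier_mat n r \<Longrightarrow> dagger (A * B) = dagger B * dagger A"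
  by (intro eq_matI) (auto simp: dagger_def scalar_prod_def bar_sum bar_mult mult.commute)

lemma dagger_four_block:
  assumes "A \<in> carrier_mat m1 n1" "B \<in> carrier_mat m1 n2" "C \<in> carrier_mat m2 n1" "D \<in> carrier_mat m2 n2"
  shows "dagger (four_block_mat A B C D) = four_block_mat (dagger A) (dagger C) (dagger B) (dagger D)"
  using assms by (intro eq_matI) (auto simp: dagger_def)

lemma one_smult_mat: "1 \<cdot>\<^sub>m A = A" for A :: "laurent mat"
  by (intro eq_matI) auto

text \<open>Explicit matrices of size \<open>1\<close> and \<open>2\<close>. With the rules below, every matrix identity of these sizes
becomes a list of identities in \<open>\<Lambda>\<close>.\<close>

definition mat1 :: "laurent \<Rightarrow> laurent mat" where "mat1 x = mat 1 1 (\<lambda>_. x)"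

lemma mat1_carrier: "mat1 x \<in> carrier_mat 1 1" by (simp add: mat1_def)

lemma mat1_zero: "0\<^sub>m 1 1 = mat1 0" "0\<^sub>m (Suc 0) (Suc 0) = mat1 0"  by (auto simp: mat1_def)

lemma mat1_one: "1\<^sub>m 1 = mat1 1" "1\<^sub>m (Suc 0) = mat1 1" by (auto simp: mat1_def)

lemma mat1_add: "mat1 x + mat1 y = mat1 (x + y)" by (auto simp: mat1_def)

lemma mat1_uminus: "- mat1 x = mat1 (- x)" by (auto simp: mat1_def)

lemma mat1_diff: "mat1 x - mat1 y = mat1 (x - y)" by (auto simp: mat1_def)

lemma mat1_mult: "mat1 x * mat1 y = mat1 (x * y)" by (auto simp: mat1_def scalar_prod_def)

lemma mat1_dagger: "dagger (mat1 x) = mat1 (bar x)" by (auto simp: mat1_def dagger_def)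

lemma mat1_index: "mat1 x $$ (0, 0) = x" "dim_row (mat1 x) = 1" "dim_col (mat1 x) = 1" by (simp_all add: mat1_def)

definition mat2 :: "'a \<Rightarrow> 'a \<Rightarrow> 'a \<Rightarrow> 'a \<Rightarrow> 'a mat" where
  "mat2 a b c d = mat 2 2 (\<lambda>(i, j). if i = 0 then (if j = 0 then a else b) else (if j = 0 then c else d))"

lemma mat2_carrier: "mat2 a b c d \<in> carrier_mat 2 2"
  by (simp add: mat2_def)

lemma mat2_index: "mat2 a b c d $$ (0, 0) = a"
  by (simp add: mat2_def)

lemma mat2_eq_iff: "mat2 a b c d = mat2 a' b' c' d' \<longleftrightarrow> a = a' \<and> b = b' \<and> c = c' \<and> d = d'"
proof
  assume e: "mat2 a b c d = mat2 a' b' c' d'"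
  have "mat2 a b c d $$ (i, j) = mat2 a' b' c' d' $$ (i, j)" for i j
    using e by simp
  from this[of 0 0] this[of 0 1] this[of 1 0] this[of 1 1]
  show "a = a' \<and> b = b' \<and> c = c' \<and> d = d'"
    by (simp add: mat2_def)
qed simp

lemma mat2_mult: "mat2 a b c d * mat2 a' b' c' d'
    = mat2 (a * a' + b * c') (a * b' + b * d') (c * a' + d * c') (c * b' + d * d')"
  for a :: "'a :: comm_ring_1"
  by (intro eq_matI) (auto simp: mat2_def scalar_prod_def less_2_cases_iff sum.atLeast0_lessThan_Suc numeral_2_eq_2)

lemma mat2_add: "mat2 a b c d + mat2 a' b' c' d' = mat2 (a + a') (b + b') (c + c') (d + d')"
  by (intro eq_matI) (auto simp: mat2_def)

lemma mat2_diff: "mat2 a b c d - mat2 a' b' c' d' = mat2 (a - a') (b - b') (c - c') (d - d')"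
  by (intro eq_matI) (auto simp: mat2_def)

lemma mat2_uminus: "- mat2 a b c d = mat2 (- a) (- b) (- c) (- d)" for a :: laurent
  by (intro eq_matI) (auto simp: mat2_def)

lemma mat2_dagger: "dagger (mat2 a b c d) = mat2 (bar a) (bar c) (bar b) (bar d)"
  by (intro eq_matI) (auto simp: mat2_def dagger_def)

lemma mat2_one: "1\<^sub>m 2 = mat2 1 0 0 1"
  by (intro eq_matI) (auto simp: mat2_def)

lemma mat2_zero: "0\<^sub>m 2 2 = mat2 0 0 0 0"
  by (intro eq_matI) (auto simp: mat2_def)

lemma mat2_addcol_0: "addcol x 0 (Suc 0) (mat2 a b c d) = mat2 (a + x * b) b (c + x * d) d" for x :: "'a :: comm_ring_1"
  by (intro eq_matI) (auto simp: mat2_def mat_addcol_def less_2_cases_iff)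

lemma mat2_addcol_1: "addcol x (Suc 0) 0 (mat2 a b c d) = mat2 a (b + x * a) c (d + x * c)" for x :: "'a :: comm_ring_1"
  by (intro eq_matI) (auto simp: mat2_def mat_addcol_def less_2_cases_iff)

lemma four_block_mat1: "four_block_mat (mat1 a) (mat1 b) (mat1 c) (mat1 d) = mat2 a b c d"
  by (intro eq_matI) (auto simp: mat1_def mat2_def)

lemma block_sum_carrier:
  "A \<in> carrier_mat m n \<Longrightarrow> B \<in> carrier_mat m' n' \<Longrightarrow> block_sum A B \<in> carrier_mat (m + m') (n + n')"
  by (simp add: block_sum_def)

lemma block_sum_mat1: "block_sum (mat1 a) (mat1 b) = mat2 a 0 0 b"
  using four_block_mat1[of a 0 0 b] by (simp add: block_sum_def mat1_index mat1_zero)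

lemma block_sum_empty: "block_sum A (1\<^sub>m 0) = A" "block_sum A (0\<^sub>m 0 0) = A"
  by (auto simp: block_sum_def)

lemma block_sum_one: "block_sum (1\<^sub>m m) (1\<^sub>m n) = 1\<^sub>m (m + n)" "block_sum (0\<^sub>m m m) (0\<^sub>m n n) = 0\<^sub>m (m + n) (m + n)"
  by (auto simp: block_sum_def intro!: eq_matI)

section \<open>Free modules and elementary matrices\<close>

text \<open>On free modules with their standard bases all the data of a based module collapse: the ambient
module is the module itself, and a homomorphism is an arbitrary matrix.\<close>

lemma free_simps [simp]:
  "ambient (free_module n) = n" "stab_rank (free_module n) = 0"
  "retr (free_module n) = 0\<^sub>m 0 n" "sect (free_module n) = 0\<^sub>m n 0"
  "based (free_module n)" "dual (free_module n) = free_module n" "idm (free_module n) = 1\<^sub>m n"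
  "mod_sum (free_module m) (free_module n) = free_module (m + n)"
  "zero_hom (free_module m) (free_module n) = 0\<^sub>m n m"
  "elements (free_module n) = carrier_vec n"
proof -
  show amb: "ambient (free_module n) = n" and "stab_rank (free_module n) = 0" for n
    by (simp_all add: free_module_def ambient_def stab_rank_def)
  show "retr (free_module n) = 0\<^sub>m 0 n" "sect (free_module n) = 0\<^sub>m n 0"
    by (simp_all add: free_module_def)
  show "based (free_module n)"
    by (auto simp: based_def free_module_def ambient_def stab_rank_def)
  show "dual (free_module n) = free_module n"
    by (simp add: dual_def free_module_def dagger_zero)
  show idm: "idm (free_module n) = 1\<^sub>m n"
    by (auto simp: idm_def free_module_def ambient_def)
  show "mod_sum (free_module m) (free_module n) = free_module (m + n)"
    by (auto simp: mod_sum_def free_module_def block_sum_def)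
  show "zero_hom (free_module m) (free_module n) = 0\<^sub>m n m"
    by (simp add: zero_hom_def amb)
  show "elements (free_module n) = carrier_vec n"
    by (auto simp: elements_def amb idm)
qed

lemma homs_free: "homs (free_module m) (free_module n) = carrier_mat n m"
  by (auto simp: homs_def)

lemma torsion_matrix_free: "A \<in> carrier_mat n m \<Longrightarrow> torsion_matrix (free_module m) (free_module n) A = A"
  by (auto simp: torsion_matrix_def)

lemma inverse_homs_free:
  "inverse_homs (free_module n) (free_module n) A B \<longleftrightarrow>
    A \<in> carrier_mat n n \<and> B \<in> carrier_mat n n \<and> B * A = 1\<^sub>m n \<and> A * B = 1\<^sub>m n"
  by (simp add: inverse_homs_def homs_free)

lemma inv_hom_free:
  assumes "A \<in> carrier_mat n n" "B \<in> carrier_mat n n" "B * A = 1\<^sub>m n" "A * B = 1\<^sub>m n"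
  shows "inv_hom (free_module n) (free_module n) A = B"
  unfolding inv_hom_def inverse_homs_free
proof (rule the_equality)
  fix C assume C: "A \<in> carrier_mat n n \<and> C \<in> carrier_mat n n \<and> C * A = 1\<^sub>m n \<and> A * C = 1\<^sub>m n"
  have "C * A * B = C * (A * B)"
    by (rule assoc_mult_mat[of _ n n _ n _ n]) (use assms C in auto)
  then show "C = B"
    using assms(2,4) C by (metis left_mult_one_mat right_mult_one_mat)
qed (use assms in simp)

lemma inv_hom_one: "inv_hom (free_module n) (free_module n) (1\<^sub>m n) = 1\<^sub>m n"
  by (rule inv_hom_free) simp_all

lemma elementary_inverse:
  assumes "A \<in> elementary_group n"
  shows "A \<in> carrier_mat n n \<and> (\<exists>B \<in> carrier_mat n n. A * B = 1\<^sub>m n \<and> B * A = 1\<^sub>m n)"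
  using assms
proof (induction rule: elementary_group.induct)
  case one
  then show ?case by (auto intro: bexI[of _ "1\<^sub>m n"])
next
  case (step A i j c)
  let ?E = "addrow_mat n c i j" and ?F = "addrow_mat n (- c) i j"
  from step.IH obtain B where A: "A \<in> carrier_mat n n" and B: "B \<in> carrier_mat n n"
    and AB: "A * B = 1\<^sub>m n" "B * A = 1\<^sub>m n" by blast
  have E: "?E \<in> carrier_mat n n" "?F \<in> carrier_mat n n" by simp_all
  have EF: "?E * ?F = 1\<^sub>m n" "?F * ?E = 1\<^sub>m n"
    using addrow_mat_inv[OF step.hyps(2,3,4), of c] addrow_mat_inv[OF step.hyps(2,3,4), of "- c"] by simp_all
  have "(A * ?E) * (?F * B) = A * (?E * ?F) * B"
    using A B E by (simp add: assoc_mult_mat[of _ n n _ n _ n] mult_carrier_mat[of _ n n _ n])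
  moreover have "(?F * B) * (A * ?E) = ?F * (B * A) * ?E"
    using A B E by (simp add: assoc_mult_mat[of _ n n _ n _ n] mult_carrier_mat[of _ n n _ n])
  ultimately have "(A * ?E) * (?F * B) = 1\<^sub>m n" "(?F * B) * (A * ?E) = 1\<^sub>m n"
    using A B E AB EF by simp_all
  then show ?case
    using A B E by (intro conjI bexI[of _ "?F * B"]) auto
qed

lemma elementary_addcol:
  assumes "A \<in> elementary_group n" "i < n" "j < n" "i \<noteq> j"
  shows "addcol c j i A \<in> elementary_group n"
  using elementary_group.step[OF assms] elementary_inverse[OF assms(1)] addcol_mat[OF _ assms(2), of A n c j]
  by simp

lemma elementary_addcol_iff:
  assumes "A \<in> carrier_mat n n" "addcol c j i A \<in> elementary_group n" "i < n" "j < n" "i \<noteq> j"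
  shows "A \<in> elementary_group n"
proof -
  have "addcol (- c) j i (addcol c j i A) = A"
    using assms by (intro eq_matI) (auto simp: mat_addcol_def)
  then show ?thesis
    using elementary_addcol[OF assms(2-5), of "- c"] by simp
qed

lemma elementary_torsion:
  assumes "A \<in> elementary_group n"
  shows "torsion_in_Z A"
proof -
  have A: "A \<in> carrier_mat n n" using elementary_inverse[OF assms] by blast
  have M: "multrow_mat n 0 1 = (1\<^sub>m n :: laurent mat)"
    by (intro eq_matI) (auto simp: multrow_mat_def)
  have b: "block_sum A (1\<^sub>m 0) = A"
    using A by (auto simp: block_sum_def)
  show ?thesis
    unfolding torsion_in_Z_def
    using A assms M b 
    by (intro conjI exI[of _ 0] exI[of _ "1::laurent"] exI[of _ "0::int"] exI[of _ A]) (auto simp: tpow_0)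
qed

lemma elementary_simple_iso:
  assumes "A \<in> elementary_group n"
  shows "simple_iso (free_module n) (free_module n) A"
  using elementary_inverse[OF assms] elementary_torsion[OF assms]
  by (auto simp: simple_iso_def module_iso_def inverse_homs_free torsion_matrix_free)

lemma one_simple: "simple_iso (free_module n) (free_module n) (1\<^sub>m n)"
  by (intro elementary_simple_iso elementary_group.one)

lemma fg_free_free: "fg_free (free_module n)"
  using one_simple[of n] by (auto simp: fg_free_def simple_iso_def)

text \<open>Column operations change a matrix of determinant \<open>1\<close> only through its bottom row, in the sense
that once the bottom row is \<open>(0, 1)\<close> the matrix is unitriangular. It therefore suffices to follow the
Euclidean algorithm on the bottom row, whatever the top row is.\<close>

definition elementary_bottom_row :: "laurent \<Rightarrow> laurent \<Rightarrow> bool" where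
  "elementary_bottom_row c d \<longleftrightarrow> (\<forall>a b. a * d - b * c = 1 \<longrightarrow> mat2 a b c d \<in> elementary_group 2)"

lemma elementary_bottom_row_unit: "elementary_bottom_row 0 1"
  unfolding elementary_bottom_row_def
proof (intro allI impI)
  fix a b :: laurent
  assume "a * 1 - b * 0 = 1"
  then have "mat2 a b 0 1 = addcol b 1 0 (1\<^sub>m 2)"
    by (simp add: mat2_one mat2_addcol_1)
  then show "mat2 a b 0 1 \<in> elementary_group 2"
    using elementary_addcol[OF elementary_group.one, of 0 2 1 b] by simp
qed

lemma elementary_bottom_row_col_0:
  assumes "elementary_bottom_row (c + x * d) d" shows "elementary_bottom_row c d"
  unfolding elementary_bottom_row_def
proof (intro allI impI)
  fix a b assume "a * d - b * c = 1"
  then have "(a + x * b) * d - b * (c + x * d) = 1" by (simp add: algebra_simps)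
  then have "addcol x 0 1 (mat2 a b c d) \<in> elementary_group 2"
    using assms by (simp add: elementary_bottom_row_def mat2_addcol_0)
  then show "mat2 a b c d \<in> elementary_group 2"
    by (rule elementary_addcol_iff[OF mat2_carrier]) simp_all
qed

lemma elementary_bottom_row_col_1:
  assumes "elementary_bottom_row c (d + x * c)" shows "elementary_bottom_row c d"
  unfolding elementary_bottom_row_def
proof (intro allI impI)
  fix a b assume "a * d - b * c = 1"
  then have "a * (d + x * c) - (b + x * a) * c = 1" by (simp add: algebra_simps)
  then have "addcol x 1 0 (mat2 a b c d) \<in> elementary_group 2"
    using assms by (simp add: elementary_bottom_row_def mat2_addcol_1)
  then show "mat2 a b c d \<in> elementary_group 2"
    by (rule elementary_addcol_iff[OF mat2_carrier]) simp_all
qed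

section \<open>Split formations on free modules\<close>

lemma Q_eq_zero: "Q_eq 1 (free_module n) (0\<^sub>m n n) (0\<^sub>m n n)"
  unfolding Q_eq_def by (auto simp: homs_free dagger_zero intro!: bexI[of _ "0\<^sub>m n n"])

text \<open>Modulo \<open>\<chi> - \<chi>\<^sup>*\<close> a \<open>2 \<times> 2\<close> matrix can be made upper triangular, and then only the classes of the
two diagonal entries and the sum of the off-diagonal ones remain.\<close>

lemma Q_eq_mat2:
  assumes "a - a' = x - bar x" "d - d' = y - bar y" "(b - b') + bar (c - c') = 0"
  shows "Q_eq 1 (free_module 2) (mat2 a b c d) (mat2 a' b' c' d')"
proof -
  have "c - c' = - bar (b - b')"
    using arg_cong[OF assms(3), of bar] by (simp add: bar_add bar_bar bar_zero add_eq_0_iff2)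
  then have "mat2 a b c d - mat2 a' b' c' d'
      = mat2 x (b - b') 0 y - of_int 1 \<cdot>\<^sub>m dagger (mat2 x (b - b') 0 y)"
    using assms by (simp add: mat2_dagger mat2_diff mat2_eq_iff bar_zero one_smult_mat)
  then show ?thesis
    unfolding Q_eq_def by (auto simp: homs_free mat2_carrier intro!: bexI[of _ "mat2 x (b - b') 0 y"])
qed

lemma hyperbolic_free:
  "hyperbolic (free_module n) = (free_module (n + n), four_block_mat (0\<^sub>m n n) (1\<^sub>m n) (0\<^sub>m n n) (0\<^sub>m n n))"
  by (simp add: hyperbolic_def)

lemma hyperbolic_free_1: "hyperbolic (free_module 1) = (free_module 2, mat2 0 1 0 0)"
proof -
  have m: "free_module (1 + 1) = free_module 2"
    by (simp add: numeral_2_eq_2)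
  show ?thesis
    unfolding hyperbolic_free m mat1_zero mat1_one four_block_mat1 ..
qed

lemma block_product:
  assumes "\<gamma> \<in> carrier_mat n n" "\<delta> \<in> carrier_mat n n" "a \<in> carrier_mat n n" "b \<in> carrier_mat n n"
  shows "four_block_mat a b (0\<^sub>m 0 n) (0\<^sub>m 0 n) * (\<gamma> @\<^sub>r \<delta>) = (a * \<gamma> + b * \<delta> :: laurent mat)"
proof -
  have "four_block_mat a b (0\<^sub>m 0 n) (0\<^sub>m 0 n) * (\<gamma> @\<^sub>r \<delta>)
     = four_block_mat (a * \<gamma> + b * \<delta>) (0\<^sub>m n 0) (0\<^sub>m 0 n) (0\<^sub>m 0 0)"
    unfolding append_rows_def using assms
    by (subst mult_four_block_mat[of _ n n _ n _ 0 _ _ n _ 0]) auto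
  then show ?thesis using assms by (auto simp: four_block_mat_def intro!: eq_matI)
qed

lemma block_product':
  assumes "\<gamma> \<in> carrier_mat n n" "\<delta> \<in> carrier_mat n n" "a \<in> carrier_mat n n" "b \<in> carrier_mat n n"
  shows "(\<gamma> @\<^sub>r \<delta>) * four_block_mat a b (0\<^sub>m 0 n) (0\<^sub>m 0 n)
    = (four_block_mat (\<gamma> * a) (\<gamma> * b) (\<delta> * a) (\<delta> * b) :: laurent mat)"
  unfolding append_rows_def using assms
  by (subst mult_four_block_mat[of _ n n _ 0 _ n _ _ n _ n]) auto

text \<open>The map \<open>q\<close> with kernel the orthogonal complement of the image of \<open>(\<gamma>, \<delta>)\<close> in \<open>H\<^sub>-(F)\<close>.\<close>

lemma skew_hyperbolic_adjoint:
  assumes "\<gamma> \<in> carrier_mat n n" "\<delta> \<in> carrier_mat n n"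
  shows "dagger (\<gamma> @\<^sub>r \<delta>) * (four_block_mat (0\<^sub>m n n) (1\<^sub>m n) (0\<^sub>m n n) (0\<^sub>m n n)
      + of_int (- 1) \<cdot>\<^sub>m dagger (four_block_mat (0\<^sub>m n n) (1\<^sub>m n) (0\<^sub>m n n) (0\<^sub>m n n)))
    = four_block_mat (- dagger \<delta>) (dagger \<gamma>) (0\<^sub>m 0 n) (0\<^sub>m 0 n)"
    (is "?j * ?\<Psi> = _")
proof -
  have d: "dagger \<gamma> \<in> carrier_mat n n" "dagger \<delta> \<in> carrier_mat n n"
    using assms by (simp_all add: dagger_carrier)
  have j: "?j = four_block_mat (dagger \<gamma>) (dagger \<delta>) (0\<^sub>m 0 n) (0\<^sub>m 0 n)"
    unfolding append_rows_def using assms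
    by (subst dagger_four_block[of _ n n _ 0 _ n]) (auto simp: dagger_zero)
  have \<Psi>: "?\<Psi> = four_block_mat (0\<^sub>m n n) (1\<^sub>m n) (- 1\<^sub>m n) (0\<^sub>m n n)"
    by (subst dagger_four_block[of _ n n _ n _ n], simp_all add: dagger_zero dagger_one)
      (auto intro!: eq_matI)
  show ?thesis unfolding j \<Psi> using d
    by (subst mult_four_block_mat[of _ n n _ n _ 0 _ _ n _ n]) auto
qed

text \<open>The matrices \<open>\<sigma>, \<sigma>'\<close> are the components of a section of \<open>q\<close>, and \<open>\<rho>, \<rho>'\<close> those of a retraction of
\<open>(\<gamma>, \<delta>)\<close>; the hypotheses say that \<open>x = j (r x) + s (q x)\<close> for all \<open>x\<close>. So an element of the kernel of \<open>q\<close>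
is the image of its retraction, and the short exact sequence of the lagrangian is based because the
matrix \<open>(j s)\<close> is elementary.\<close>

lemma split_formation_free:
  assumes c: "\<gamma> \<in> carrier_mat n n" "\<delta> \<in> carrier_mat n n" "\<theta> \<in> carrier_mat n n"
      "\<sigma> \<in> carrier_mat n n" "\<sigma>' \<in> carrier_mat n n" "\<rho> \<in> carrier_mat n n" "\<rho>' \<in> carrier_mat n n"
    and sym: "dagger \<gamma> * \<delta> = \<theta> + dagger \<theta>"
    and rj: "\<rho> * \<gamma> + \<rho>' * \<delta> = 1\<^sub>m n"
    and qs: "- dagger \<delta> * \<sigma> + dagger \<gamma> * \<sigma>' = 1\<^sub>m n"
    and sum: "\<gamma> * \<rho> - \<sigma> * dagger \<delta> = 1\<^sub>m n" "\<gamma> * \<rho>' + \<sigma> * dagger \<gamma> = 0\<^sub>m n n"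
      "\<delta> * \<rho> - \<sigma>' * dagger \<delta> = 0\<^sub>m n n" "\<delta> * \<rho>' + \<sigma>' * dagger \<gamma> = 1\<^sub>m n"
    and el: "four_block_mat \<gamma> \<sigma> \<delta> \<sigma>' \<in> elementary_group (n + n)"
  shows "split_formation (Formation (free_module n) (free_module n) \<gamma> \<delta> \<theta>)"
proof -
  let ?\<psi> = "four_block_mat (0\<^sub>m n n) (1\<^sub>m n) (0\<^sub>m n n) (0\<^sub>m n n) :: laurent mat"
  let ?q = "four_block_mat (- dagger \<delta>) (dagger \<gamma>) (0\<^sub>m 0 n) (0\<^sub>m 0 n)"
  let ?r = "four_block_mat \<rho> \<rho>' (0\<^sub>m 0 n) (0\<^sub>m 0 n)"
  let ?j = "\<gamma> @\<^sub>r \<delta>" and ?s = "\<sigma> @\<^sub>r \<sigma>'"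
  have d: "dagger \<gamma> \<in> carrier_mat n n" "dagger \<delta> \<in> carrier_mat n n" "dagger \<theta> \<in> carrier_mat n n"
    using c by (simp_all add: dagger_carrier)
  have q: "dagger ?j * (?\<psi> + of_int (- 1) \<cdot>\<^sub>m dagger ?\<psi>) = ?q"
    by (rule skew_hyperbolic_adjoint[OF c(1,2)])
  have carr: "?j \<in> carrier_mat (n + n) n" "?s \<in> carrier_mat (n + n) n"
    "?q \<in> carrier_mat n (n + n)" "?r \<in> carrier_mat n (n + n)" "?\<psi> \<in> carrier_mat (n + n) (n + n)"
    using c d by (auto intro!: carrier_matI)
  have symd: "dagger \<delta> * \<gamma> = dagger \<gamma> * \<delta>"
  proof -
    have "dagger \<delta> * \<gamma> = dagger (dagger \<gamma> * \<delta>)"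
      using dagger_mult[OF d(1) c(2)] by (simp add: dagger_dagger)
    also have "\<dots> = dagger \<theta> + \<theta>"
      unfolding sym using dagger_add[OF c(3) d(3)] by (simp add: dagger_dagger)
    also have "\<dots> = dagger \<gamma> * \<delta>"
      unfolding sym using c(3) d(3) by (rule comm_add_mat[rotated])
    finally show ?thesis .
  qed
  have qj: "?q * ?j = 0\<^sub>m n n"
    using block_product[OF c(1,2), of "- dagger \<delta>" "dagger \<gamma>"] c d symd
    by (auto simp: uminus_l_inv_mat)
  have qs': "?q * ?s = 1\<^sub>m n"
    using block_product[OF c(4,5), of "- dagger \<delta>" "dagger \<gamma>"] d qs by simp
  have rj': "?r * ?j = 1\<^sub>m n"
    using block_product[OF c(1,2,6,7)] rj by simp
  have jr: "?j * ?r + ?s * ?q = 1\<^sub>m (n + n)"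
  proof -
    have "?j * ?r + ?s * ?q = four_block_mat (\<gamma> * \<rho>) (\<gamma> * \<rho>') (\<delta> * \<rho>) (\<delta> * \<rho>')
      + four_block_mat (\<sigma> * - dagger \<delta>) (\<sigma> * dagger \<gamma>) (\<sigma>' * - dagger \<delta>) (\<sigma>' * dagger \<gamma>)"
      using block_product'[OF c(1,2,6,7)] block_product'[OF c(4,5), of "- dagger \<delta>" "dagger \<gamma>"] d by simp
    also have "\<dots> = four_block_mat (\<gamma> * \<rho> - \<sigma> * dagger \<delta>) (\<gamma> * \<rho>' + \<sigma> * dagger \<gamma>)
      (\<delta> * \<rho> - \<sigma>' * dagger \<delta>) (\<delta> * \<rho>' + \<sigma>' * dagger \<gamma>)"
      using c d by (subst add_four_block_mat[of _ n n _ n _ n])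
        (auto intro!: arg_cong4[where f = four_block_mat] simp: minus_add_uminus_mat)
    finally show ?thesis unfolding sum by simp
  qed
  have psi: "dagger ?j * ?\<psi> * ?j = \<theta> + dagger \<theta>"
  proof -
    have "dagger ?j = four_block_mat (dagger \<gamma>) (dagger \<delta>) (0\<^sub>m 0 n) (0\<^sub>m 0 n)"
      unfolding append_rows_def using c
      by (subst dagger_four_block[of _ n n _ 0 _ n]) (auto simp: dagger_zero)
    then have "dagger ?j * ?\<psi> = four_block_mat (0\<^sub>m n n) (dagger \<gamma>) (0\<^sub>m 0 n) (0\<^sub>m 0 n)"
      using d by (simp add: mult_four_block_mat[of _ n n _ n _ 0 _ _ n _ n])
    then show ?thesis
      using block_product[OF c(1,2), of "0\<^sub>m n n" "dagger \<gamma>"] c d sym by simp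
  qed
  have "simple_lagrangian (- 1) (hyperbolic (free_module n)) (free_module n) ?j"
    unfolding simple_lagrangian_def hyperbolic_free Let_def fst_conv snd_conv q free_simps psi homs_free
  proof (intro conjI)
    show "quadratic_form (free_module (n + n), ?\<psi>)"
      using carr by (simp add: quadratic_form_def homs_free)
    show "\<exists>r\<in>carrier_mat n (n + n). r * ?j = 1\<^sub>m n"
      using carr rj' by blast
    \<comment> \<open>The class of \<open>\<gamma>\<^sup>* \<delta> = \<theta> + \<theta>\<^sup>*\<close> vanishes in \<open>Q\<^sub>-\<close> because of \<open>\<chi> = \<theta>\<close>.\<close>
    show "Q_eq (- 1) (free_module n) (\<theta> + dagger \<theta>) (0\<^sub>m n n)"
      unfolding Q_eq_def using c d by (auto simp: homs_free intro!: bexI[of _ \<theta>] eq_matI)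
    show "(*\<^sub>v) ?j ` carrier_vec n = {x \<in> carrier_vec (n + n). ?q *\<^sub>v x = 0\<^sub>v n}"
    proof (intro equalityI subsetI)
      fix x assume "x \<in> (*\<^sub>v) ?j ` carrier_vec n"
      then obtain z where z: "z \<in> carrier_vec n" "x = ?j *\<^sub>v z" by blast
      have "?q *\<^sub>v x = (?q * ?j) *\<^sub>v z"
        using z carr by (simp add: assoc_mult_mat_vec[of _ n "n + n" _ n])
      then show "x \<in> {x \<in> carrier_vec (n + n). ?q *\<^sub>v x = 0\<^sub>v n}"
        using z carr qj mult_mat_vec_carrier[of ?j "n + n" n z] by (auto intro!: eq_vecI)
    next
      fix x assume "x \<in> {x \<in> carrier_vec (n + n). ?q *\<^sub>v x = 0\<^sub>v n}"
      then have x: "x \<in> carrier_vec (n + n)" "?q *\<^sub>v x = 0\<^sub>v n" by auto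
      have rx: "?r *\<^sub>v x \<in> carrier_vec n"
        using x carr by (intro mult_mat_vec_carrier)
      have "x = (?j * ?r + ?s * ?q) *\<^sub>v x"
        using x by (simp add: jr)
      also have "\<dots> = ?j * ?r *\<^sub>v x + ?s * ?q *\<^sub>v x"
        using x carr by (intro add_mult_distrib_mat_vec[of _ "n + n" "n + n"]) auto
      also have "?s * ?q *\<^sub>v x = ?s *\<^sub>v (?q *\<^sub>v x)"
        using x carr by (intro assoc_mult_mat_vec) auto
      also have "\<dots> = 0\<^sub>v (n + n)"
        unfolding x(2) using carr by (intro eq_vecI) auto
      also have "?j * ?r *\<^sub>v x = ?j *\<^sub>v (?r *\<^sub>v x)"
        using x carr by (intro assoc_mult_mat_vec) auto
      also have "\<dots> + 0\<^sub>v (n + n) = ?j *\<^sub>v (?r *\<^sub>v x)"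
        using rx carr by (intro right_zero_vec[OF mult_mat_vec_carrier[of _ _ n]])
      finally show "x \<in> (*\<^sub>v) ?j ` carrier_vec n" using rx by blast
    qed
    show "based_exact (free_module n) (free_module (n + n)) (free_module n) ?j ?q"
      unfolding based_exact_def free_simps homs_free
    proof (intro conjI bexI[of _ ?s])
      have "four_block_mat ?j ?s (0\<^sub>m 0 n) (0\<^sub>m 0 n) = four_block_mat \<gamma> \<sigma> \<delta> \<sigma>'"
        unfolding append_rows_def using c by (intro eq_matI) auto
      then show "simple_iso (free_module (n + n)) (free_module (n + n))
          (four_block_mat ?j ?s (0\<^sub>m 0 n) (0\<^sub>m 0 n))"
        using elementary_simple_iso[OF el] by simp
    qed (use carr qj qs' in simp_all)
  qed (use carr in simp_all)
  then show ?thesis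
    using c sym by (simp add: split_formation_def homs_free)
qed

lemma trivial_free: "trivial_formation (free_module n) = Formation (free_module n) (free_module n) (0\<^sub>m n n) (1\<^sub>m n) (0\<^sub>m n n)"
  by (simp add: trivial_formation_def)

lemma formation_sum_trivial_0:
  "formation_sum (trivial_formation (free_module n)) (trivial_formation (free_module 0)) = trivial_formation (free_module n)"
  by (simp add: formation_sum_def trivial_free block_sum_empty)

lemma split_trivial_free_1: "split_formation (trivial_formation (free_module 1))"
proof -
  have "elementary_bottom_row 1 0"
    by (rule elementary_bottom_row_col_1[of _ _ 1], simp, rule elementary_bottom_row_col_0[of _ "- 1"], simp add: elementary_bottom_row_unit)
  then have "mat2 0 (- 1) 1 0 \<in> elementary_group 2"
    by (simp add: elementary_bottom_row_def)
  then show ?thesis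
    unfolding trivial_free
    by (intro split_formation_free[where \<sigma> = "mat1 (- 1)" and \<sigma>' = "mat1 0" and \<rho> = "mat1 0" and \<rho>' = "mat1 1"])
      (simp_all add: mat1_zero mat1_one mat1_carrier[simplified] mat1_dagger mat1_mult mat1_add mat1_diff mat1_uminus
        bar_zero bar_one four_block_mat1 numeral_2_eq_2)
qed

lemma rank_one_form_mat1: "rank_one_form \<theta> = (free_module 1, mat1 \<theta>)"
  by (simp add: rank_one_form_def mat1_def)

lemma bdry_rank_one: 
  "bar \<theta> = \<theta> \<Longrightarrow> bdry (rank_one_form \<theta>) = Formation (free_module 1) (free_module 1) (mat1 1) (mat1 (2 * \<theta>)) (mat1 \<theta>)"
  by (simp add: bdry_def rank_one_form_mat1 mat1_one mat1_dagger mat1_add flip: mult_2)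

lemma bdry_rank_one_stab:
  assumes "bar \<theta> = \<theta>"
  shows "formation_sum (bdry (rank_one_form \<theta>)) (trivial_formation (free_module 1))
    = Formation (free_module 2) (free_module 2) (mat2 1 0 0 0) (mat2 (2 * \<theta>) 0 0 1) (mat2 \<theta> 0 0 0)"
  by (simp add: bdry_rank_one[OF assms] formation_sum_def trivial_free mat1_one mat1_zero block_sum_mat1 numeral_2_eq_2)

text \<open>The section and the retraction are the sums of those of the two summands. In the resulting \<open>4 \<times> 4\<close>
matrix one column operation creates the entry \<open>2\<theta>\<close>, and three more give the signed exchange of
the second and the fourth coordinate.\<close>

lemma split_bdry_rank_one_stab:
  assumes "bar \<theta> = \<theta>"
  shows "split_formation (Formation (free_module 2) (free_module 2) (mat2 1 0 0 0) (mat2 (2 * \<theta>) 0 0 1) (mat2 \<theta> 0 0 0))"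
proof (rule split_formation_free[where \<sigma> = "mat2 0 0 0 (- 1)" and \<sigma>' = "mat2 1 0 0 0"
      and \<rho> = "mat2 1 0 0 0" and \<rho>' = "mat2 0 0 0 1"])
  let ?J = "four_block_mat (mat2 1 0 0 0) (mat2 0 0 0 (- 1)) (mat2 (2 * \<theta>) 0 0 1) (mat2 1 0 0 0) :: laurent mat"
  have "?J = addcol 1 1 3 (addcol (- 1) 3 1 (addcol 1 1 3 (addcol (2 * \<theta>) 0 2 (1\<^sub>m 4))))"
  proof (intro eq_matI)
    fix i j :: nat
    assume "i < dim_row (addcol 1 1 3 (addcol (- 1) 3 1 (addcol 1 1 3 (addcol (2 * \<theta>) 0 2 (1\<^sub>m 4)))))"
      "j < dim_col (addcol 1 1 3 (addcol (- 1) 3 1 (addcol 1 1 3 (addcol (2 * \<theta>) 0 2 (1\<^sub>m 4)))))"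
    then have "i \<in> {0, 1, 2, 3}" "j \<in> {0, 1, 2, 3}"
      by auto
    then show "?J $$ (i, j) = addcol 1 1 3 (addcol (- 1) 3 1 (addcol 1 1 3 (addcol (2 * \<theta>) 0 2 (1\<^sub>m 4)))) $$ (i, j)"
      by (elim insertE emptyE) (simp_all add: mat2_def mat_addcol_def)
  qed (simp_all add: mat2_def)
  moreover have "addcol 1 1 3 (addcol (- 1) 3 1 (addcol 1 1 3 (addcol (2 * \<theta>) 0 2 (1\<^sub>m 4)))) \<in> elementary_group 4"
    by (intro elementary_addcol elementary_group.one) simp_all
  ultimately show "?J \<in> elementary_group (2 + 2)"
    by simp
qed (simp_all add: mat2_carrier mat2_dagger mat2_mult mat2_add mat2_diff mat2_one mat2_zero mat2_uminus
    assms bar_zero bar_one bar_mult bar_numeral)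

lemma iso_id_free: "fF x = free_module n \<Longrightarrow> fG x = free_module n \<Longrightarrow> iso_id x = (1\<^sub>m n, 1\<^sub>m n, 0\<^sub>m n n)"
  by (simp add: iso_id_def)

lemma formation_iso_id:
  assumes "split_formation x" "fF x = free_module n" "fG x = free_module n"
  shows "formation_iso x x (1\<^sub>m n, 1\<^sub>m n, 0\<^sub>m n n)"
proof -
  have c: "fgamma x \<in> carrier_mat n n" "fdelta x \<in> carrier_mat n n" "ftheta x \<in> carrier_mat n n"
    using assms by (auto simp: split_formation_def homs_free)
  then have d: "dagger (fdelta x) \<in> carrier_mat n n"
    by (simp add: dagger_carrier)
  show ?thesis
    using assms c d
    by (auto simp: one_simple homs_free Q_eq_def dagger_one dagger_zero inv_hom_one intro!: bexI[of _ "0\<^sub>m n n"])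
qed

lemma iso_comp_id_left:
  assumes "fF x = free_module n" "fF y = free_module n" "\<alpha> \<in> elementary_group n"
    "\<beta> \<in> carrier_mat n n" "\<nu> \<in> carrier_mat n n"
  shows "iso_comp x y (1\<^sub>m n, 1\<^sub>m n, 0\<^sub>m n n) (\<alpha>, \<beta>, \<nu>) = (\<alpha>, \<beta>, \<nu>)"
proof -
  obtain B where B: "\<alpha> \<in> carrier_mat n n" "B \<in> carrier_mat n n" "\<alpha> * B = 1\<^sub>m n" "B * \<alpha> = 1\<^sub>m n"
    using elementary_inverse[OF assms(3)] by blast
  then have "inv_hom (free_module n) (free_module n) \<alpha> = B"
    by (intro inv_hom_free)
  then show ?thesis
    using assms B dagger_carrier[OF B(2)] by simp
qed

lemma iso_comp_id_right:
  assumes "fF x = free_module n" "fF y = free_module n" "\<alpha> \<in> carrier_mat n n"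
    "\<beta> \<in> carrier_mat n n" "\<nu> \<in> carrier_mat n n"
  shows "iso_comp x y (\<alpha>, \<beta>, \<nu>) (1\<^sub>m n, 1\<^sub>m n, 0\<^sub>m n n) = (\<alpha>, \<beta>, \<nu>)"
  using assms by (simp add: inv_hom_one dagger_one)

text \<open>The constant homotopy \<open>\<Delta> = 0\<close>.\<close>

lemma homotopic_refl:
  assumes "formation_iso x y (\<alpha>, \<beta>, \<nu>)" "fF x = free_module n" "fF y = free_module n" "fG x = free_module n" "fG y = free_module n"
  shows "homotopic x y (\<alpha>, \<beta>, \<nu>) (\<alpha>, \<beta>, \<nu>)"
proof -
  obtain B where B: "inverse_homs (free_module n) (free_module n) \<beta> B"
    using assms by (auto simp: simple_iso_def module_iso_def)
  then have inv: "inv_hom (free_module n) (free_module n) \<beta> = B"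
    by (intro inv_hom_free) (simp_all add: inverse_homs_free)
  have c: "B \<in> carrier_mat n n" "\<alpha> \<in> carrier_mat n n" "\<nu> \<in> carrier_mat n n"
      "fgamma x \<in> carrier_mat n n" "fdelta x \<in> carrier_mat n n" "fdelta y \<in> carrier_mat n n" "ftheta x \<in> carrier_mat n n"
    using assms B by (auto simp: inverse_homs_free homs_free simple_iso_def module_iso_def split_formation_def)
  then have d: "dagger B \<in> carrier_mat n n" "dagger \<alpha> \<in> carrier_mat n n"
    "dagger (fdelta x) \<in> carrier_mat n n" "dagger (fdelta y) \<in> carrier_mat n n"
    by (simp_all add: dagger_carrier)
  have 1: "dagger B - dagger B = dagger (fdelta y) * 0\<^sub>m n n"
    using d(1,4) by simp
  have 2: "\<alpha> - \<alpha> = 0\<^sub>m n n * dagger (fdelta x)"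
    using c(2) d(3) by simp
  have ANu: "\<alpha> * \<nu> * dagger \<alpha> \<in> carrier_mat n n"
    using c(2,3) d(2) by (intro mult_carrier_mat)
  have "- (\<alpha> * fgamma x) + 0\<^sub>m n n * ftheta x \<in> carrier_mat n n"
    using c(2,4,7) by (intro add_carrier_mat mult_carrier_mat[of _ n n]) simp_all
  then have "(- (\<alpha> * fgamma x) + 0\<^sub>m n n * ftheta x) * dagger (0\<^sub>m n n) = 0\<^sub>m n n"
    by (simp add: dagger_zero right_mult_zero_mat)
  with ANu have 3: "Q_eq 1 (free_module n) (\<alpha> * \<nu> * dagger \<alpha> - \<alpha> * \<nu> * dagger \<alpha>)
      ((- (\<alpha> * fgamma x) + 0\<^sub>m n n * ftheta x) * dagger (0\<^sub>m n n))"
    by (simp add: Q_eq_zero)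
  show ?thesis
    unfolding homotopic.simps assms(2-5) inv free_simps homs_free
    using assms(1) 1 2 3 by (intro conjI bexI[of _ "0\<^sub>m n n"]) simp_all
qed

text \<open>The stabilisation is trivial on both sides: the additional summand is the zero module, and the
isomorphisms of trivial formations are identities. That the class of an automorphism contains this
automorphism is needed to read off invariants from equalities of classes.\<close>

lemma stably_homotopic_refl:
  assumes x: "fF x = free_module m" "fG x = free_module m"
    and t: "split_formation (trivial_formation (free_module n))"
    and iso: "formation_iso (formation_sum x (trivial_formation (free_module n)))
        (formation_sum x (trivial_formation (free_module n))) (\<alpha>, \<beta>, \<nu>)"
    and el: "\<alpha> \<in> elementary_group (m + n)"
  shows "stably_homotopic x x (free_module n, free_module n, \<alpha>, \<beta>, \<nu>) (free_module n, free_module n, \<alpha>, \<beta>, \<nu>)"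
proof -
  let ?t = "trivial_formation (free_module n)" and ?z = "trivial_formation (free_module 0)"
  let ?i = "(1\<^sub>m n, 1\<^sub>m n, 0\<^sub>m n n) :: triple"
  have tF: "fF (trivial_formation (free_module i)) = free_module i"
      "fG (trivial_formation (free_module i)) = free_module i" for i
    by (simp_all add: trivial_free)
  have id: "formation_iso ?t ?t ?i"
    by (rule formation_iso_id[OF t]) (simp_all add: tF)
  have xt: "fF (formation_sum x ?t) = free_module (m + n)" "fG (formation_sum x ?t) = free_module (m + n)"
    by (simp_all add: formation_sum_def x trivial_free)
  have xtz: "fF (formation_sum (formation_sum x ?t) ?z) = free_module (m + n)"
    by (simp add: formation_sum_def x trivial_free)
  have carr: "\<alpha> \<in> carrier_mat (m + n) (m + n)" "\<beta> \<in> carrier_mat (m + n) (m + n)" "\<nu> \<in> carrier_mat (m + n) (m + n)"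
    using iso by (auto simp: xt homs_free simple_iso_def module_iso_def inverse_homs_free)
  have "iso_sum (iso_id x) ?i = (1\<^sub>m (m + n), 1\<^sub>m (m + n), 0\<^sub>m (m + n) (m + n))"
    by (simp add: iso_id_free[OF x] block_sum_one)
  moreover have "iso_sum (\<alpha>, \<beta>, \<nu>) (iso_id ?z) = (\<alpha>, \<beta>, \<nu>)"
    by (simp add: iso_id_free[OF tF] block_sum_empty)
  ultimately have st: "stabilise x x ?t ?t ?z ?t (\<alpha>, \<beta>, \<nu>) ?i ?i = (\<alpha>, \<beta>, \<nu>)"
    unfolding stabilise_def
    by (simp only: formation_sum_trivial_0 iso_comp_id_left[OF xtz xtz el carr(2,3)]
        iso_comp_id_right[OF xt(1) xt(1) carr])
  show ?thesis
    unfolding stably_homotopic.simps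
  proof (intro exI conjI)
    show "homotopic (formation_sum x ?t) (formation_sum x ?t)
        (stabilise x x ?t ?t ?z ?t (\<alpha>, \<beta>, \<nu>) ?i ?i) (stabilise x x ?t ?t ?z ?t (\<alpha>, \<beta>, \<nu>) ?i ?i)"
      unfolding st by (rule homotopic_refl[OF iso xt(1) xt(1) xt(2) xt(2)])
    show "formation_iso ?t (formation_sum ?t ?z) ?i" "formation_iso ?t (formation_sum ?t ?z) ?i"
      "formation_iso (formation_sum ?t ?z) ?t ?i" "formation_iso (formation_sum ?t ?z) ?t ?i"
      unfolding formation_sum_trivial_0 by (rule id)+
  qed (simp_all only: free_simps(5))
qed

lemma one_in_Aut: "quadratic_form v \<Longrightarrow> fst v = free_module m \<Longrightarrow> 1\<^sub>m m \<in> Aut v"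
  by (auto simp: Aut_def isometry_def one_simple quadratic_form_def homs_free Q_eq_def dagger_one dagger_zero
      intro!: bexI[of _ "0\<^sub>m m m"])

lemma act_one:
  assumes v: "fst v = free_module m" and el: "\<alpha> \<in> elementary_group (m + n)"
    and carr: "\<beta> \<in> carrier_mat (m + n) (m + n)" "\<nu> \<in> carrier_mat (m + n) (m + n)"
  shows "act v (1\<^sub>m m) (1\<^sub>m m) (free_module n, free_module n, \<alpha>, \<beta>, \<nu>) = (free_module n, free_module n, \<alpha>, \<beta>, \<nu>)"
proof -
  let ?t = "trivial_formation (free_module n)"
  have x: "fF (formation_sum (bdry v) ?t) = free_module (m + n)"
    by (simp add: formation_sum_def bdry_def v trivial_free)
  have "iso_sum (bdry_iso v (1\<^sub>m m)) (iso_id ?t) = (1\<^sub>m (m + n), 1\<^sub>m (m + n), 0\<^sub>m (m + n) (m + n))"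
    by (simp add: iso_id_free[of _ n] trivial_free bdry_iso_def v block_sum_one)
  then show ?thesis
    using elementary_inverse[OF el] carr
    by (simp only: act.simps Let_def v inv_hom_one iso_comp_id_left[OF x x el carr] iso_comp_id_right[OF x x _ carr])
qed

section \<open>Boundary automorphisms with prescribed corner\<close>

text \<open>The automorphism of \<open>\<partial>(\<Lambda>, \<theta>) \<oplus> (\<Lambda>, \<Lambda>\<^sup>*)\<close> with corner \<open>a\<close>, for \<open>a bar a + 2\<theta> (s + bar s) = 1\<close>. The relation
\<open>\<alpha>\<^sup>-\<^sup>* \<delta> = \<delta> \<beta>\<close> forces the lower left entry of \<open>\<alpha>\<close> to be divisible by \<open>2\<theta>\<close>, and the simplest choice
\<open>2\<theta>\<close> leads to the right column \<open>(- (s + bar s), bar a)\<close> of determinant \<open>1\<close>. Then \<open>\<beta> = \<delta>\<^sup>-\<^sup>1 \<alpha>\<^sup>-\<^sup>* \<delta>\<close>, and the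
remaining relation determines \<open>\<nu> + \<nu>\<^sup>*\<close>; the matrix \<open>\<nu>\<close> is its upper triangular half.\<close>

definition bdry_aut_alpha where "bdry_aut_alpha \<theta> a s = mat2 a (- (s + bar s)) (2 * \<theta>) (bar a)"

definition bdry_aut_alpha_inv where "bdry_aut_alpha_inv \<theta> a s = mat2 (bar a) (s + bar s) (- (2 * \<theta>)) a"

definition bdry_aut_beta where "bdry_aut_beta \<theta> a s = mat2 a (- 1) (2 * \<theta> * (s + bar s)) (bar a)"

definition bdry_aut_nu where "bdry_aut_nu \<theta> a s = mat2 (- bar s) (- bar a) 0 \<theta>"

lemma bdry_aut_alpha_inverse:
  assumes "a * bar a + 2 * \<theta> * (s + bar s) = 1"
  shows "bdry_aut_alpha \<theta> a s * bdry_aut_alpha_inv \<theta> a s = 1\<^sub>m 2" "bdry_aut_alpha_inv \<theta> a s * bdry_aut_alpha \<theta> a s = 1\<^sub>m 2"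
proof -
  show "bdry_aut_alpha \<theta> a s * bdry_aut_alpha_inv \<theta> a s = 1\<^sub>m 2"
    unfolding bdry_aut_alpha_def bdry_aut_alpha_inv_def mat2_mult mat2_one mat2_eq_iff
    by (intro conjI; use assms in \<open>Groebner_Basis.algebra | simp add: algebra_simps\<close>)
  show "bdry_aut_alpha_inv \<theta> a s * bdry_aut_alpha \<theta> a s = 1\<^sub>m 2"
    unfolding bdry_aut_alpha_def bdry_aut_alpha_inv_def mat2_mult mat2_one mat2_eq_iff
    by (intro conjI; use assms in \<open>Groebner_Basis.algebra | simp add: algebra_simps\<close>)
qed

lemma inv_hom_bdry_aut_alpha:
  assumes "a * bar a + 2 * \<theta> * (s + bar s) = 1"
  shows "inv_hom (free_module 2) (free_module 2) (bdry_aut_alpha \<theta> a s) = bdry_aut_alpha_inv \<theta> a s"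
  using bdry_aut_alpha_inverse[OF assms]
  by (intro inv_hom_free) (simp_all add: bdry_aut_alpha_def bdry_aut_alpha_inv_def mat2_carrier)

lemma bdry_aut_beta_elementary:
  assumes "a * bar a + 2 * \<theta> * (s + bar s) = 1"
  shows "bdry_aut_beta \<theta> a s \<in> elementary_group 2"
proof -
  have "elementary_bottom_row (2 * \<theta> * (s + bar s)) (bar a)"
  proof (rule elementary_bottom_row_col_0[of _ a])
    have e: "2 * \<theta> * (s + bar s) + a * bar a = 1"
      using assms by (simp add: add.commute)
    show "elementary_bottom_row (2 * \<theta> * (s + bar s) + a * bar a) (bar a)"
      unfolding e
      by (rule elementary_bottom_row_col_1[of _ _ "1 - bar a"], simp, rule elementary_bottom_row_col_0[of _ "- 1"],
          simp add: elementary_bottom_row_unit)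
  qed
  moreover have "a * bar a - (- 1) * (2 * \<theta> * (s + bar s)) = 1"
    using assms by simp
  ultimately show ?thesis
    unfolding elementary_bottom_row_def bdry_aut_beta_def by blast
qed

lemma bdry_aut_formation_iso:
  assumes \<theta>: "bar \<theta> = \<theta>" and a: "a * bar a + 2 * \<theta> * (s + bar s) = 1"
    and el: "bdry_aut_alpha \<theta> a s \<in> elementary_group 2"
  defines "x \<equiv> Formation (free_module 2) (free_module 2) (mat2 1 0 0 0) (mat2 (2 * \<theta>) 0 0 1) (mat2 \<theta> 0 0 0)"
  shows "formation_iso x x (bdry_aut_alpha \<theta> a s, bdry_aut_beta \<theta> a s, bdry_aut_nu \<theta> a s)"
proof -
  have sx: "split_formation x"
    unfolding x_def by (rule split_bdry_rank_one_stab[OF \<theta>])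
  define b where "b = bar a"
  define s' where "s' = bar s"
  have bars: "bar a = b" "bar b = a" "bar s = s'" "bar s' = s"
    by (simp_all add: b_def s'_def bar_bar)
  have ab: "a * b + 2 * \<theta> * (s + s') = 1"
    using a by (simp add: bars)
  note bar_simps = bar_add bar_diff bar_uminus bar_mult bar_numeral bar_one bar_zero bars \<theta>
  have Q: "Q_eq 1 (free_module 2)
      (mat2 \<theta> 0 0 0 + dagger (mat2 (2 * \<theta>) 0 0 1) * bdry_aut_nu \<theta> a s * mat2 (2 * \<theta>) 0 0 1)
      (dagger (bdry_aut_beta \<theta> a s) * mat2 \<theta> 0 0 0 * bdry_aut_beta \<theta> a s)"
    unfolding bdry_aut_nu_def bdry_aut_alpha_inv_def bdry_aut_beta_def mat2_dagger mat2_mult mat2_add bar_simps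
    \<comment> \<open>The top left entries differ by \<open>2 \<theta>\<^sup>2 (s - bar s)\<close>.\<close>
    by (rule Q_eq_mat2[where x = "2 * \<theta> * \<theta> * s" and y = 0];
        unfold bar_simps; use ab in \<open>Groebner_Basis.algebra | simp add: algebra_simps\<close>)
  have 2: "bdry_aut_alpha \<theta> a s * mat2 1 0 0 0
      + bdry_aut_alpha \<theta> a s * (bdry_aut_nu \<theta> a s + dagger (bdry_aut_nu \<theta> a s)) * mat2 (2 * \<theta>) 0 0 1
      = mat2 1 0 0 0 * bdry_aut_beta \<theta> a s"
    unfolding bdry_aut_nu_def bdry_aut_alpha_inv_def bdry_aut_alpha_def bdry_aut_beta_def mat2_dagger mat2_mult mat2_add bar_simps mat2_eq_iff
    by (intro conjI; use ab in \<open>Groebner_Basis.algebra | simp add: algebra_simps\<close>)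
  have 3: "dagger (bdry_aut_alpha_inv \<theta> a s) * mat2 (2 * \<theta>) 0 0 1 = mat2 (2 * \<theta>) 0 0 1 * bdry_aut_beta \<theta> a s"
    unfolding bdry_aut_alpha_inv_def bdry_aut_beta_def mat2_dagger mat2_mult mat2_add bar_simps mat2_eq_iff
    by (intro conjI; use ab in \<open>Groebner_Basis.algebra | simp add: algebra_simps\<close>)
  have "bdry_aut_nu \<theta> a s \<in> carrier_mat 2 2"
    by (simp add: bdry_aut_nu_def mat2_carrier)
  then show ?thesis
    unfolding formation_iso.simps using sx Q 2 3 elementary_simple_iso[OF el]
      elementary_simple_iso[OF bdry_aut_beta_elementary[OF a]]
    by (simp add: x_def homs_free inv_hom_bdry_aut_alpha[OF a])
qed

text \<open>The entry is \<open>s\<close> up to an element \<open>x - bar x\<close>, here with \<open>x = \<theta> * (bar s)\<^sup>2\<close> if \<open>\<theta>\<close> is an integer.\<close>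

lemma bdry_aut_union_entry:
  assumes "a * bar a + 2 * \<theta> * (s + bar s) = 1"
  shows "(bdry_aut_alpha \<theta> a s * bdry_aut_nu \<theta> a s * dagger (bdry_aut_alpha \<theta> a s)) $$ (0, 0)
    = s + \<theta> * ((bar s)\<^sup>2 - s\<^sup>2)"
  unfolding bdry_aut_alpha_def bdry_aut_nu_def mat2_dagger mat2_mult mat2_index bar_add bar_uminus bar_bar
  using assms by Groebner_Basis.algebra

lemma union_form_bdry_aut:
  assumes "a * bar a + 2 * \<theta> * (s + bar s) = 1"
  shows "union_form (rank_one_form \<theta>) (free_module 1, free_module 1, bdry_aut_alpha \<theta> a s, bdry_aut_beta \<theta> a s, bdry_aut_nu \<theta> a s)
    = (free_module 2, mat2 \<theta> 0 a (- (s + \<theta> * ((bar s)\<^sup>2 - s\<^sup>2))))"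
proof -
  have tl: "top_left (free_module 1) A = mat1 (A $$ (0, 0))" for A
    unfolding top_left_def mat1_def by (intro eq_matI) auto
  have a: "bdry_aut_alpha \<theta> a s $$ (0, 0) = a"
    by (simp add: bdry_aut_alpha_def mat2_index)
  have m: "mod_sum (free_module 1) (free_module 1) = free_module 2"
    by (simp add: numeral_2_eq_2)
  show ?thesis
    unfolding union_form.simps Let_def rank_one_form_mat1 fst_conv snd_conv tl bdry_aut_union_entry[OF assms] a
      free_simps(6) m free_simps(9) mat1_zero mat1_uminus four_block_mat1 ..
qed

section \<open>A family of hyperbolic unions\<close>

text \<open>The corner \<open>a\<^sub>k\<close> and the parameter \<open>s\<^sub>k\<close> that belong to the basis \<open>w = (1 + 2p t\<^sup>k, p - 2p\<^sup>2 t\<^sup>k)\<close>,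
\<open>w' = (t\<^sup>k, 1 - p t\<^sup>k)\<close> of \<open>H\<^sub>+(\<Lambda>)\<close>.\<close>

definition family_entry :: "int \<Rightarrow> int \<Rightarrow> laurent" where
  "family_entry p k = 1 - 4 * (of_int p)\<^sup>2 + 2 * of_int p * tpow k"

definition family_selfint :: "int \<Rightarrow> int \<Rightarrow> laurent" where
  "family_selfint p k = of_int p - tpow (- k)"

lemma family_relation:
  fixes p k :: int
  defines "a \<equiv> family_entry p k" and "s \<equiv> family_selfint p k"
  shows "a * bar a + 2 * of_int (p * (1 - 4 * p\<^sup>2)) * (s + bar s) = 1"
  unfolding a_def s_def family_entry_def family_selfint_def bar_simps
    of_int_mult of_int_diff of_int_power of_int_numeral of_int_1 minus_minus
  using tpow_inverse[of k] by Groebner_Basis.algebra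

text \<open>The Euclidean algorithm works because \<open>t\<^sup>k\<close> is a unit: up to multiples of one another the
entries of \<open>(2\<theta>, bar a)\<close> become \<open>(- 4p\<^sup>2 t\<^sup>-\<^sup>k, 1 - 4p\<^sup>2 + 2p t\<^sup>-\<^sup>k)\<close>, and now the first one times \<open>- t\<^sup>k\<close>
cancels the summand \<open>- 4p\<^sup>2\<close> of the second.\<close>

lemma family_elementary:
  fixes p k :: int
  shows "bdry_aut_alpha (of_int (p * (1 - 4 * p\<^sup>2))) (family_entry p k) (family_selfint p k) \<in> elementary_group 2"
proof -
  define P T S where "P = (of_int p :: laurent)" and "T = tpow k" and "S = tpow (- k)"
  have TS: "T * S = 1" by (simp add: T_def S_def tpow_inverse)
  have \<theta>: "of_int (p * (1 - 4 * p\<^sup>2)) = P * (1 - 4 * P\<^sup>2)"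
    by (simp add: P_def)
  have a: "bar (family_entry p k) = 1 - 4 * P\<^sup>2 + 2 * P * S"
    by (simp add: family_entry_def bar_simps P_def S_def)
  have "elementary_bottom_row (2 * (P * (1 - 4 * P\<^sup>2))) (1 - 4 * P\<^sup>2 + 2 * P * S)"
  proof (rule elementary_bottom_row_col_0[of _ "- (2 * P)"])
    have 1: "2 * (P * (1 - 4 * P\<^sup>2)) + - (2 * P) * (1 - 4 * P\<^sup>2 + 2 * P * S) = - 4 * P\<^sup>2 * S"
      by (simp add: algebra_simps power2_eq_square)
    have 2: "1 - 4 * P\<^sup>2 + 2 * P * S + - T * (- 4 * P\<^sup>2 * S) = 1 + 2 * P * S"
      using TS by Groebner_Basis.algebra
    have 3: "- 4 * P\<^sup>2 * S + 2 * P * (1 + 2 * P * S) = 2 * P"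
      by (simp add: algebra_simps power2_eq_square)
    have 4: "1 + 2 * P * S + - S * (2 * P) = 1" "2 * P + - (2 * P) * 1 = 0"
      by (simp_all add: algebra_simps)
    show "elementary_bottom_row (2 * (P * (1 - 4 * P\<^sup>2)) + - (2 * P) * (1 - 4 * P\<^sup>2 + 2 * P * S)) (1 - 4 * P\<^sup>2 + 2 * P * S)"
      unfolding 1
      apply (rule elementary_bottom_row_col_1[of _ _ "- T"], unfold 2)
      apply (rule elementary_bottom_row_col_0[of _ "2 * P"], unfold 3)
      apply (rule elementary_bottom_row_col_1[of _ _ "- S"], unfold 4)
      apply (rule elementary_bottom_row_col_0[of _ "- (2 * P)"], unfold 4)
      apply (rule elementary_bottom_row_unit)
      done
  qed
  then show ?thesis
    using family_relation[of p k]
    unfolding bdry_aut_alpha_def elementary_bottom_row_def \<theta> a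
    by (simp add: algebra_simps)
qed

definition family :: "int \<Rightarrow> int \<Rightarrow> stable_iso" where
  "family p k = (let \<theta> = of_int (p * (1 - 4 * p\<^sup>2)); a = family_entry p k; s = family_selfint p k
     in (free_module 1, free_module 1, bdry_aut_alpha \<theta> a s, bdry_aut_beta \<theta> a s, bdry_aut_nu \<theta> a s))"

lemma family_stable_iso:
  fixes p k :: int
  defines "v \<equiv> rank_one_form (of_int (p * (1 - 4 * p\<^sup>2)))"
  shows "family p k \<in> stable_isos (bdry v) (bdry v)"
proof -
  let ?\<theta> = "of_int (p * (1 - 4 * p\<^sup>2)) :: laurent"
  let ?a = "family_entry p k" and ?s = "family_selfint p k"
  let ?x = "formation_sum (bdry v) (trivial_formation (free_module 1))"
  have "formation_iso ?x ?x (bdry_aut_alpha ?\<theta> ?a ?s, bdry_aut_beta ?\<theta> ?a ?s, bdry_aut_nu ?\<theta> ?a ?s)"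
    unfolding v_def bdry_rank_one_stab[OF bar_of_int]
    by (rule bdry_aut_formation_iso[OF bar_of_int family_relation family_elementary])
  then show ?thesis
    unfolding stable_isos_def family_def Let_def mem_Collect_eq prod.case
    by (intro conjI free_simps(5) fg_free_free)
qed

text \<open>The isometry sends the standard basis of the union to \<open>w\<close>, \<open>w'\<close>. Its matrix has determinant
\<open>1\<close>, and the Euclidean algorithm on the bottom row shows that it is elementary.\<close>

lemma family_union_hyperbolic:
  "isometric 1 (union_form (rank_one_form (of_int (p * (1 - 4 * p\<^sup>2)))) (family p k)) (hyperbolic (free_module 1))"
proof -
  define P T S where "P = (of_int p :: laurent)" and "T = tpow k" and "S = tpow (- k)"
  have TS: "T * S = 1" by (simp add: T_def S_def tpow_inverse)
  have bars: "bar P = P" "bar T = S" "bar S = T"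
    by (simp_all add: P_def T_def S_def bar_simps)
  let ?\<theta> = "of_int (p * (1 - 4 * p\<^sup>2)) :: laurent"
  have \<theta>: "?\<theta> = P * (1 - 4 * P\<^sup>2)"
    by (simp add: P_def)
  have s: "family_selfint p k = P - S" and a: "family_entry p k = 1 - 4 * P\<^sup>2 + 2 * P * T"
    by (simp_all add: family_selfint_def family_entry_def P_def T_def S_def)
  let ?u = "P - S + P * (1 - 4 * P\<^sup>2) * ((P - T)\<^sup>2 - (P - S)\<^sup>2)"
  have union: "union_form (rank_one_form ?\<theta>) (family p k)
      = (free_module 2, mat2 (P * (1 - 4 * P\<^sup>2)) 0 (1 - 4 * P\<^sup>2 + 2 * P * T) (- ?u))"
    unfolding family_def Let_def
    by (subst union_form_bdry_aut[OF family_relation]) (simp only: \<theta> s a bar_diff bars)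
  let ?h = "mat2 (1 + 2 * P * T) T (P - 2 * P\<^sup>2 * T) (1 - P * T)"
  have "elementary_bottom_row (P - 2 * P\<^sup>2 * T) (1 - P * T)"
  proof (rule elementary_bottom_row_col_0[of _ "- (2 * P)"])
    have 1: "P - 2 * P\<^sup>2 * T + - (2 * P) * (1 - P * T) = - P"
      by (simp add: algebra_simps power2_eq_square)
    have 2: "1 - P * T + - T * - P = 1" "- P + P * 1 = 0"
      by (simp_all add: algebra_simps)
    show "elementary_bottom_row (P - 2 * P\<^sup>2 * T + - (2 * P) * (1 - P * T)) (1 - P * T)"
      unfolding 1
      apply (rule elementary_bottom_row_col_1[of _ _ "- T"], unfold 2)
      apply (rule elementary_bottom_row_col_0[of _ P], unfold 2)
      apply (rule elementary_bottom_row_unit)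
      done
  qed
  moreover have "(1 + 2 * P * T) * (1 - P * T) - T * (P - 2 * P\<^sup>2 * T) = 1"
    by (simp add: algebra_simps power2_eq_square)
  ultimately have "?h \<in> elementary_group 2"
    unfolding elementary_bottom_row_def by blast
  then have iso: "simple_iso (free_module 2) (free_module 2) ?h"
    by (rule elementary_simple_iso)
  have Q: "Q_eq 1 (free_module 2) (dagger ?h * mat2 0 1 0 0 * ?h)
      (mat2 (P * (1 - 4 * P\<^sup>2)) 0 (1 - 4 * P\<^sup>2 + 2 * P * T) (- ?u))"
    unfolding mat2_dagger mat2_mult bar_simps bars
    \<comment> \<open>The value of \<open>w\<close> is \<open>\<theta> + 2p\<^sup>2 (t\<^sup>-\<^sup>k - t\<^sup>k)\<close>; the witness \<open>y\<close> absorbs the correction term in the corner of \<open>\<alpha> \<nu> \<alpha>\<^sup>*\<close>.\<close>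
    by (rule Q_eq_mat2[where x = "2 * P\<^sup>2 * S" and y = "P * (1 - 4 * P\<^sup>2) * (P - T)\<^sup>2"];
        unfold bar_simps bars; use TS in \<open>Groebner_Basis.algebra\<close>)
  have "isometry 1 (union_form (rank_one_form ?\<theta>) (family p k)) (hyperbolic (free_module 1)) ?h"
    unfolding isometry_def union hyperbolic_free_1 fst_conv snd_conv
    using iso Q by (simp add: quadratic_form_def homs_free mat2_carrier)
  then show ?thesis
    unfolding isometric_def by blast
qed

section \<open>The corner entry as an invariant\<close>

lemma ambient_mod_sum: "ambient (mod_sum M N) = ambient M + ambient N"
  by (simp add: ambient_def mod_sum_def block_sum_def)

lemma ambient_dual: "based M \<Longrightarrow> ambient (dual M) = ambient M"
  by (auto simp: ambient_def dual_def based_def dagger_def)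

text \<open>Sizes of matrices between stably free modules enter only through the ambient ranks. They are
needed because the modules in a stable isomorphism or a stable homotopy are arbitrary.\<close>

lemma ambient_dual_sum_dual: "ambient (dual (mod_sum M (dual N))) = ambient (dual M) + ambient N"
  by (simp add: ambient_def dual_def mod_sum_def block_sum_def dagger_def)

lemma idm_carrier: "based M \<Longrightarrow> idm M \<in> carrier_mat (ambient M) (ambient M)"
  by (auto simp: idm_def based_def ambient_def intro!: carrier_matI)

lemma formation_iso_alpha_carrier:
  "formation_iso x y (\<alpha>, \<beta>, \<nu>) \<Longrightarrow> \<alpha> \<in> carrier_mat (ambient (fF y)) (ambient (fF x))"
  by (auto simp: simple_iso_def module_iso_def inverse_homs_def homs_def)

lemma fF_simps: "fF (formation_sum x y) = mod_sum (fF x) (fF y)" "fF (trivial_formation P) = P"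
  "fG (formation_sum x y) = mod_sum (fG x) (fG y)" "fG (trivial_formation P) = dual P"
  "fdelta (formation_sum x y) = block_sum (fdelta x) (fdelta y)" "fdelta (trivial_formation P) = idm (dual P)"
  by (simp_all add: formation_sum_def trivial_formation_def)

text \<open>The corner is multiplicative as soon as one of the two factors has no further entries in the
row or column concerned. This applies to block diagonal factors.\<close>

lemma corner_mult:
  assumes A: "A \<in> carrier_mat m (1 + n)" and B: "B \<in> carrier_mat (1 + n) r" and "0 < m" "0 < r"
    and z: "(\<forall>j. 0 < j \<and> j < 1 + n \<longrightarrow> A $$ (0, j) = 0) \<or> (\<forall>j. 0 < j \<and> j < 1 + n \<longrightarrow> B $$ (j, 0) = 0)"
  shows "(A * B) $$ (0, 0) = A $$ (0, 0) * (B $$ (0, 0) :: laurent)"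
proof -
  have "(A * B) $$ (0, 0) = (\<Sum>j = 0..<1 + n. A $$ (0, j) * B $$ (j, 0))"
    using assms by (simp add: scalar_prod_def)
  also have "\<dots> = A $$ (0, 0) * B $$ (0, 0) + (\<Sum>j = 1..<1 + n. A $$ (0, j) * B $$ (j, 0))"
    by (subst sum.atLeast_Suc_lessThan) simp_all
  also have "(\<Sum>j = 1..<1 + n. A $$ (0, j) * B $$ (j, 0)) = 0"
    using z by (intro sum.neutral) auto
  finally show ?thesis by simp
qed

lemma block_sum_corner:
  assumes "A \<in> carrier_mat 1 1" "H \<in> carrier_mat m n"
  shows "block_sum A H $$ (0, 0) = A $$ (0, 0)"
    "\<forall>j. 0 < j \<and> j < 1 + n \<longrightarrow> block_sum A H $$ (0, j) = 0"
    "\<forall>i. 0 < i \<and> i < 1 + m \<longrightarrow> block_sum A H $$ (i, 0) = 0"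
  using assms by (auto simp: block_sum_def)

lemma corner_conjugate:
  assumes M: "M \<in> carrier_mat (1 + m) (1 + n)"
    and A: "A \<in> carrier_mat 1 1" and B: "B \<in> carrier_mat 1 1"
    and H: "H \<in> carrier_mat m' m" and G: "G \<in> carrier_mat n n'"
  shows "(block_sum A H * M * block_sum B G) $$ (0, 0) = A $$ (0, 0) * M $$ (0, 0) * B $$ (0, 0)"
proof -
  have AH: "block_sum A H \<in> carrier_mat (1 + m') (1 + m)" and BG: "block_sum B G \<in> carrier_mat (1 + n) (1 + n')"
    using A B H G by (simp_all only: block_sum_carrier)
  have "(block_sum A H * M * block_sum B G) $$ (0, 0) = (block_sum A H * M) $$ (0, 0) * block_sum B G $$ (0, 0)"
    by (rule corner_mult[OF mult_carrier_mat[OF AH M] BG]) (use block_sum_corner[OF B G] in auto)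
  also have "(block_sum A H * M) $$ (0, 0) = block_sum A H $$ (0, 0) * M $$ (0, 0)"
    by (rule corner_mult[OF AH M]) (use block_sum_corner[OF A H] in auto)
  finally show ?thesis
    by (simp add: block_sum_corner[OF A H] block_sum_corner[OF B G])
qed

text \<open>The first column of \<open>\<delta>\<^sup>*\<close> is \<open>(2\<theta>, 0, \<dots>, 0)\<close>, so the corner of \<open>\<alpha>' - \<alpha> = \<Delta> \<delta>\<^sup>*\<close> is a multiple of \<open>2\<theta>\<close>.\<close>

lemma homotopic_corner:
  assumes \<theta>: "bar \<theta> = \<theta>" and P: "based P"
    and h: "homotopic (formation_sum (bdry (rank_one_form \<theta>)) (trivial_formation P))
      (formation_sum (bdry (rank_one_form \<theta>)) (trivial_formation Q)) (\<alpha>, \<beta>, \<nu>) (\<alpha>', \<beta>', \<nu>')"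
  shows "\<exists>z. \<alpha>' $$ (0, 0) - \<alpha> $$ (0, 0) = z * (2 * \<theta>)"
proof -
  let ?x = "formation_sum (bdry (rank_one_form \<theta>)) (trivial_formation P)"
  let ?y = "formation_sum (bdry (rank_one_form \<theta>)) (trivial_formation Q)"
  obtain \<Delta> where \<Delta>: "\<Delta> \<in> homs (dual (fG ?x)) (fF ?y)" and eq: "\<alpha>' - \<alpha> = \<Delta> * dagger (fdelta ?x)"
    using h by auto
  have f: "fF (bdry (rank_one_form \<theta>)) = free_module 1" "fG (bdry (rank_one_form \<theta>)) = free_module 1"
    "fdelta (bdry (rank_one_form \<theta>)) = mat1 (2 * \<theta>)"
    by (simp_all add: bdry_rank_one[OF \<theta>])
  have carr: "\<Delta> \<in> carrier_mat (1 + ambient Q) (1 + ambient P)"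
    using \<Delta> by (simp add: homs_def fF_simps f ambient_mod_sum ambient_dual_sum_dual)
  have \<alpha>: "\<alpha> \<in> carrier_mat (1 + ambient Q) (1 + ambient P)" "\<alpha>' \<in> carrier_mat (1 + ambient Q) (1 + ambient P)"
    using h formation_iso_alpha_carrier[of ?x ?y] by (auto simp: fF_simps f ambient_mod_sum simp del: formation_iso.simps)
  have D: "idm (dual P) \<in> carrier_mat (ambient P) (ambient P)"
  proof -
    have "idm (dual P) = 1\<^sub>m (ambient P) - dagger (retr P) * dagger (sect P)"
      using ambient_dual[OF P] by (simp add: idm_def dual_def)
    then show ?thesis
      using P by (auto simp: based_def dagger_def ambient_def intro!: carrier_matI)
  qed
  have d: "fdelta ?x = block_sum (mat1 (2 * \<theta>)) (idm (dual P))"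
    by (simp add: fF_simps f)
  have dc: "fdelta ?x \<in> carrier_mat (1 + ambient P) (1 + ambient P)"
    unfolding d using D by (intro block_sum_carrier mat1_carrier)
  note corner = block_sum_corner[OF mat1_carrier[of "2 * \<theta>"] D, folded d]
  have "\<alpha>' $$ (0, 0) - \<alpha> $$ (0, 0) = (\<alpha>' - \<alpha>) $$ (0, 0)"
    using \<alpha> by simp
  also have "\<dots> = \<Delta> $$ (0, 0) * dagger (fdelta ?x) $$ (0, 0)"
    unfolding eq
  proof (rule corner_mult[OF carr dagger_carrier[OF dc]])
    show "(\<forall>j. 0 < j \<and> j < 1 + ambient P \<longrightarrow> \<Delta> $$ (0, j) = 0)
      \<or> (\<forall>j. 0 < j \<and> j < 1 + ambient P \<longrightarrow> dagger (fdelta ?x) $$ (j, 0) = 0)"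
      using corner(2) dc by (auto simp: dagger_def bar_zero)
  qed simp_all
  also have "dagger (fdelta ?x) $$ (0, 0) = 2 * \<theta>"
    using corner(1) dc by (simp add: dagger_def bar_mult bar_numeral \<theta> mat1_index)
  finally show ?thesis by blast
qed

text \<open>All the matrices that are composed with \<open>\<alpha>\<close> in a stabilisation are block diagonal with corner \<open>1\<close>.\<close>

lemma stabilise_corner:
  assumes x: "fF x = free_module 1" "fF y = free_module 1"
    and f: "\<alpha> \<in> carrier_mat (1 + ambient P') (1 + ambient P)" and R: "based R"
    and g: "formation_iso (trivial_formation W) (formation_sum (trivial_formation P) (trivial_formation R)) g"
    and h: "formation_iso (formation_sum (trivial_formation P') (trivial_formation R)) (trivial_formation W') h"
  shows "fst (stabilise x y (trivial_formation P) (trivial_formation P') (trivial_formation R) (trivial_formation W)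
      (\<alpha>, \<beta>, \<nu>) g h) $$ (0, 0) = \<alpha> $$ (0, 0)"
proof -
  obtain ga gb gn where g': "g = (ga, gb, gn)" by (cases g)
  obtain ha hb hn where h': "h = (ha, hb, hn)" by (cases h)
  have G: "ga \<in> carrier_mat (ambient P + ambient R) (ambient W)"
    using formation_iso_alpha_carrier[OF g[unfolded g']] by (simp add: fF_simps ambient_mod_sum)
  have H: "ha \<in> carrier_mat (ambient W') (ambient P' + ambient R)"
    using formation_iso_alpha_carrier[OF h[unfolded h']] by (simp add: fF_simps ambient_mod_sum)
  have M: "block_sum \<alpha> (idm R) \<in> carrier_mat (1 + (ambient P' + ambient R)) (1 + (ambient P + ambient R))"
    using block_sum_carrier[OF f idm_carrier[OF R]] by (simp add: add.assoc)
  have "fst (stabilise x y (trivial_formation P) (trivial_formation P') (trivial_formation R) (trivial_formation W)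
      (\<alpha>, \<beta>, \<nu>) g h) = block_sum (1\<^sub>m 1) ha * block_sum \<alpha> (idm R) * block_sum (1\<^sub>m 1) ga"
    by (simp add: stabilise_def g' h' iso_id_def x fF_simps)
  moreover have "block_sum \<alpha> (idm R) $$ (0, 0) = \<alpha> $$ (0, 0)"
    using f by (auto simp: block_sum_def)
  ultimately show ?thesis
    using corner_conjugate[OF M one_carrier_mat one_carrier_mat H G] by simp
qed

lemma stably_homotopic_corner:
  assumes \<theta>: "bar \<theta> = \<theta>"
    and \<alpha>1: "\<alpha>1 \<in> carrier_mat (1 + ambient P1') (1 + ambient P1)"
    and \<alpha>2: "\<alpha>2 \<in> carrier_mat (1 + ambient P2') (1 + ambient P2)"
    and h: "stably_homotopic (bdry (rank_one_form \<theta>)) (bdry (rank_one_form \<theta>))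
      (P1, P1', \<alpha>1, \<beta>1, \<nu>1) (P2, P2', \<alpha>2, \<beta>2, \<nu>2)"
  shows "\<exists>z. \<alpha>2 $$ (0, 0) - \<alpha>1 $$ (0, 0) = z * (2 * \<theta>)"
proof -
  let ?b = "bdry (rank_one_form \<theta>)" and ?t = trivial_formation
  have b: "fF ?b = free_module 1"
    by (simp add: bdry_rank_one[OF \<theta>])
  obtain R1 R2 P Q g1 g2 h1 h2 where based: "based R1" "based R2" "based P"
    and g1: "formation_iso (?t P) (formation_sum (?t P1) (?t R1)) g1"
    and g2: "formation_iso (?t P) (formation_sum (?t P2) (?t R2)) g2"
    and h1: "formation_iso (formation_sum (?t P1') (?t R1)) (?t Q) h1"
    and h2: "formation_iso (formation_sum (?t P2') (?t R2)) (?t Q) h2"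
    and hom: "homotopic (formation_sum ?b (?t P)) (formation_sum ?b (?t Q))
        (stabilise ?b ?b (?t P1) (?t P1') (?t R1) (?t P) (\<alpha>1, \<beta>1, \<nu>1) g1 h1)
        (stabilise ?b ?b (?t P2) (?t P2') (?t R2) (?t P) (\<alpha>2, \<beta>2, \<nu>2) g2 h2)"
    using h unfolding stably_homotopic.simps by blast
  obtain a1 b1 n1 where s1: "stabilise ?b ?b (?t P1) (?t P1') (?t R1) (?t P) (\<alpha>1, \<beta>1, \<nu>1) g1 h1 = (a1, b1, n1)"
    by (metis prod_cases3)
  obtain a2 b2 n2 where s2: "stabilise ?b ?b (?t P2) (?t P2') (?t R2) (?t P) (\<alpha>2, \<beta>2, \<nu>2) g2 h2 = (a2, b2, n2)"
    by (metis prod_cases3)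
  have "a1 $$ (0, 0) = \<alpha>1 $$ (0, 0)" "a2 $$ (0, 0) = \<alpha>2 $$ (0, 0)"
    using stabilise_corner[OF b b \<alpha>1 based(1) g1 h1, of \<beta>1 \<nu>1] s1
      stabilise_corner[OF b b \<alpha>2 based(2) g2 h2, of \<beta>2 \<nu>2] s2 by simp_all
  then show ?thesis
    using homotopic_corner[OF \<theta> based(3) hom[unfolded s1 s2]] by simp
qed

lemma Aut_rank_one:
  assumes c: "c \<noteq> 0" and g: "g \<in> Aut (rank_one_form (of_int c))"
  shows "\<exists>u n. u \<in> {1, - 1} \<and> g = mat1 (of_int u * tpow n)
    \<and> inv_hom (free_module 1) (free_module 1) g = mat1 (of_int u * tpow (- n))"
proof -
  have gc: "g \<in> carrier_mat 1 1"
    using g by (auto simp: Aut_def isometry_def rank_one_form_mat1 simple_iso_def module_iso_def inverse_homs_free)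
  define x where "x = g $$ (0, 0)"
  have gx: "g = mat1 x"
    using gc by (auto simp: x_def mat1_def)
  have "Q_eq 1 (free_module 1) (dagger (mat1 x) * mat1 (of_int c) * mat1 x) (mat1 (of_int c))"
    using g by (simp add: Aut_def isometry_def rank_one_form_mat1 gx)
  then obtain \<chi> where \<chi>: "\<chi> \<in> carrier_mat 1 1" and
    eq: "mat1 (bar x * of_int c * x - of_int c) = \<chi> - of_int 1 \<cdot>\<^sub>m dagger \<chi>"
    unfolding Q_eq_def by (auto simp: homs_free mat1_dagger mat1_mult mat1_diff)
  have "bar x * of_int c * x - of_int c = \<chi> $$ (0, 0) - bar (\<chi> $$ (0, 0))"
    using arg_cong[OF eq, of "\<lambda>A. A $$ (0, 0)"] \<chi> by (simp add: mat1_index dagger_def)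
  then obtain u n where u: "u \<in> {1, - 1}" and x: "x = of_int u * tpow n"
    using norm_one_monomial[OF c] by blast
  have "x * (of_int u * tpow (- n)) = of_int (u * u) * (tpow n * tpow (- n))"
    by (simp add: x ac_simps)
  then have inv: "x * (of_int u * tpow (- n)) = 1"
    using u by (auto simp: tpow_inverse)
  have "inv_hom (free_module 1) (free_module 1) g = mat1 (of_int u * tpow (- n))"
    using inv by (intro inv_hom_free) (simp_all add: gx mat1_carrier[simplified] mat1_mult mat1_one mult.commute)
  then show ?thesis
    using u gx x by blast
qed

lemma act_corner:
  assumes v: "v = rank_one_form \<theta>" and based: "based P" "based P'"
    and \<alpha>: "\<alpha> \<in> carrier_mat (1 + ambient P') (1 + ambient P)"
    and g: "inv_hom (free_module 1) (free_module 1) g = mat1 y" and h: "h = mat1 x"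
  shows "\<exists>\<alpha>' \<beta>' \<nu>'. act v g h (P, P', \<alpha>, \<beta>, \<nu>) = (P, P', \<alpha>', \<beta>', \<nu>')
    \<and> \<alpha>' \<in> carrier_mat (1 + ambient P') (1 + ambient P) \<and> \<alpha>' $$ (0, 0) = x * \<alpha> $$ (0, 0) * y"
proof -
  let ?\<alpha> = "block_sum (mat1 x) (idm P') * \<alpha> * block_sum (mat1 y) (idm P)"
  have v1: "fst v = free_module 1"
    by (simp add: v rank_one_form_mat1)
  have "\<exists>\<beta>' \<nu>'. act v g h (P, P', \<alpha>, \<beta>, \<nu>) = (P, P', ?\<alpha>, \<beta>', \<nu>')"
    by (simp add: act.simps Let_def bdry_iso_def iso_id_def fF_simps v1 g[simplified] h)
  moreover have "?\<alpha> \<in> carrier_mat (1 + ambient P') (1 + ambient P)"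
    by (rule mult_carrier_mat[OF mult_carrier_mat[OF _ \<alpha>]])
      (rule block_sum_carrier[OF mat1_carrier idm_carrier[OF based(2)]],
        rule block_sum_carrier[OF mat1_carrier idm_carrier[OF based(1)]])
  moreover have "?\<alpha> $$ (0, 0) = x * \<alpha> $$ (0, 0) * y"
    using corner_conjugate[OF \<alpha> mat1_carrier mat1_carrier idm_carrier[OF based(2)] idm_carrier[OF based(1)]]
    by (simp add: mat1_index)
  ultimately show ?thesis by blast
qed

section \<open>Infinitely many classes\<close>

text \<open>A congruence modulo \<open>2\<theta>\<close> is a congruence modulo \<open>2p (1 - 4p\<^sup>2)\<close> of all coefficients. The constant
coefficient is odd if \<open>n \<noteq> 0\<close>, and the coefficient at \<open>t\<^sup>k\<close> is \<open>2p\<close> if \<open>n = 0\<close> and \<open>k \<noteq> l\<close>.\<close>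

lemma family_entries_inequivalent:
  assumes p: "p \<noteq> 0" and k: "k \<ge> 1" and l: "l \<ge> 1" and u: "u \<in> {1, - 1}"
    and eq: "family_entry p k - of_int u * tpow n * family_entry p l
      = z * (2 * of_int (p * (1 - 4 * p\<^sup>2)))"
  shows "k = l"
proof (rule ccontr)
  assume "k \<noteq> l"
  let ?m = "1 - 4 * p\<^sup>2"
  let ?c = "\<lambda>j. (?m when j = 0) + (2 * p when j = k) - (u * ?m when j = n) - (u * (2 * p) when j = n + l)"
  have fam: "family_entry p i = of_int ?m * tpow 0 + of_int (2 * p) * tpow i" for i
    by (simp add: family_entry_def tpow_0)
  have expand: "family_entry p k - of_int u * tpow n * family_entry p l
      = of_int ?m * tpow 0 + of_int (2 * p) * tpow k - of_int (u * ?m) * (tpow n * tpow 0)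
        - of_int (u * (2 * p)) * (tpow n * tpow l)"
    unfolding fam of_int_mult by (simp add: algebra_simps)
  have "Poly_Mapping.lookup (family_entry p k - of_int u * tpow n * family_entry p l) j = ?c j" for j
    unfolding expand tpow_add lookup_add lookup_minus lookup_of_int_mult lookup_tpow
    by (simp add: when_def)
  moreover have "z * (2 * of_int (p * ?m)) = of_int (2 * p * ?m) * z"
    by (simp add: ac_simps)
  ultimately have c: "?c j = 2 * p * ?m * Poly_Mapping.lookup z j" for j
    unfolding eq by (metis lookup_of_int_mult)
  have even_c: "even (?c j)" for j
    unfolding c by simp
  have n: "n = 0"
  proof (rule ccontr)
    assume "n \<noteq> 0"
    then show False
      using even_c[of 0] k by (simp add: when_def split: if_splits)
  qed
  have "2 * p = 2 * p * (?m * Poly_Mapping.lookup z k)"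
    using c[of k] n k \<open>k \<noteq> l\<close> by (simp add: when_def)
  then have "?m * Poly_Mapping.lookup z k = 1"
    using p by simp
  then have "?m dvd 1"
    by (metis dvd_triv_left)
  then have "\<bar>?m\<bar> = 1"
    by simp
  moreover have "p\<^sup>2 \<ge> 1"
    using p by (simp add: int_one_le_iff_zero_less)
  ultimately show False
    by linarith
qed

theorem theorem5p8:
  fixes p :: int
  assumes "p \<noteq> 0"
  shows "infinite (bAut (hyperbolic (free_module 1)) (rank_one_form (of_int (p * (1 - 4 * p\<^sup>2)))))"
proof -
  define c where "c = p * (1 - 4 * p\<^sup>2)"
  define v where "v = rank_one_form (of_int c)"
  let ?b = "bdry v" and ?H = "hyperbolic (free_module 1)"
  define r where "r = {(stable_class ?b ?b f, stable_class ?b ?b (act v g h f)) | f g h.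
    f \<in> stable_isos ?b ?b \<and> g \<in> Aut v \<and> h \<in> Aut v}"
  \<comment> \<open>The index is shifted because the corner entries are told apart for \<open>k \<ge> 1\<close> only.\<close>
  define C where "C k = stable_class ?b ?b (family p (int k + 1))" for k
  have "4 * p\<^sup>2 \<noteq> 1" by presburger
  then have c0: "c \<noteq> 0"
    using assms by (simp add: c_def)
  have fam: "family p k \<in> stable_isos ?b ?b" for k
    unfolding v_def c_def by (rule family_stable_iso)
  have refl: "family p k \<in> stable_class ?b ?b (family p k)"
    and act1: "act v (1\<^sub>m 1) (1\<^sub>m 1) (family p k) = family p k" for k
  proof -
    let ?\<theta> = "of_int c :: laurent" and ?a = "family_entry p k" and ?s = "family_selfint p k"
    have el: "bdry_aut_alpha ?\<theta> ?a ?s \<in> elementary_group (1 + 1)"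
      using family_elementary[of p k] by (simp add: c_def numeral_2_eq_2)
    have f: "family p k = (free_module 1, free_module 1, bdry_aut_alpha ?\<theta> ?a ?s, bdry_aut_beta ?\<theta> ?a ?s, bdry_aut_nu ?\<theta> ?a ?s)"
      by (simp add: family_def Let_def c_def)
    have iso: "formation_iso (formation_sum ?b (trivial_formation (free_module 1)))
        (formation_sum ?b (trivial_formation (free_module 1)))
        (bdry_aut_alpha ?\<theta> ?a ?s, bdry_aut_beta ?\<theta> ?a ?s, bdry_aut_nu ?\<theta> ?a ?s)"
      using fam[of k] unfolding f stable_isos_def by blast
    have b: "fF ?b = free_module 1" "fG ?b = free_module 1" "fst v = free_module 1"
      by (simp_all add: v_def bdry_def rank_one_form_mat1)
    have "stably_homotopic ?b ?b (family p k) (family p k)"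
      unfolding f by (rule stably_homotopic_refl[OF b(1,2) split_trivial_free_1 iso el])
    then show "family p k \<in> stable_class ?b ?b (family p k)"
      using fam by (simp add: stable_class_def)
    have "bdry_aut_beta ?\<theta> ?a ?s \<in> carrier_mat (1 + 1) (1 + 1)" "bdry_aut_nu ?\<theta> ?a ?s \<in> carrier_mat (1 + 1) (1 + 1)"
      by (simp_all add: bdry_aut_beta_def bdry_aut_nu_def mat2_carrier flip: numeral_2_eq_2)
    then show "act v (1\<^sub>m 1) (1\<^sub>m 1) (family p k) = family p k"
      unfolding f by (rule act_one[OF b(3) el])
  qed
  have one: "1\<^sub>m 1 \<in> Aut v"
    by (rule one_in_Aut) (simp_all add: v_def rank_one_form_mat1 quadratic_form_def homs_free mat1_carrier[simplified])
  have "C k \<in> bIso ?H v" for k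
  proof -
    have "isometric 1 (union_form v (family p (int k + 1))) ?H"
      unfolding v_def c_def by (rule family_union_hyperbolic)
    then show ?thesis
      unfolding bIso_def Iso_def C_def using fam by blast
  qed
  then have sub: "range (\<lambda>k. r `` {C k}) \<subseteq> bAut ?H v"
    unfolding bAut_def r_def by (auto intro!: quotientI)
  have "inj (\<lambda>k. r `` {C k})"
  proof (rule injI)
    fix k l
    assume eq: "r `` {C k} = r `` {C l}"
    \<comment> \<open>The identities of \<open>v\<close> relate \<open>C k\<close> to itself, so equal orbits give a relation between \<open>C l\<close> and \<open>C k\<close>. The
      stable isomorphism \<open>f\<close> in this relation is only known to have the same class as the representative of \<open>C l\<close>.\<close>
    have "(C k, stable_class ?b ?b (act v (1\<^sub>m 1) (1\<^sub>m 1) (family p (int k + 1)))) \<in> r"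
      unfolding r_def C_def using fam one by blast
    then have "(C k, C k) \<in> r"
      unfolding act1 C_def .
    then have "(C l, C k) \<in> r"
      using eq by blast
    then obtain f g h where f: "f \<in> stable_isos ?b ?b" and g: "g \<in> Aut v" and h: "h \<in> Aut v"
      and Cl: "C l = stable_class ?b ?b f" and Ck: "C k = stable_class ?b ?b (act v g h f)"
      unfolding r_def by blast
    obtain P P' \<alpha> \<beta> \<nu> where f': "f = (P, P', \<alpha>, \<beta>, \<nu>)"
      by (metis prod_cases5)
    have based: "based P" "based P'" and
      iso: "formation_iso (formation_sum ?b (trivial_formation P)) (formation_sum ?b (trivial_formation P')) (\<alpha>, \<beta>, \<nu>)"
      using f unfolding f' stable_isos_def by blast+
    have \<alpha>: "\<alpha> \<in> carrier_mat (1 + ambient P') (1 + ambient P)"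
      using formation_iso_alpha_carrier[OF iso]
      by (simp add: fF_simps ambient_mod_sum v_def bdry_def rank_one_form_mat1)
    obtain u n where u: "u \<in> {1, - 1}" and hu: "h = mat1 (of_int u * tpow n)"
      using Aut_rank_one[OF c0 h[unfolded v_def]] by blast
    obtain w m where w: "w \<in> {1, - 1}"
      and gw: "inv_hom (free_module 1) (free_module 1) g = mat1 (of_int w * tpow (- m))"
      using Aut_rank_one[OF c0 g[unfolded v_def]] by blast
    obtain \<alpha>' \<beta>' \<nu>' where act: "act v g h f = (P, P', \<alpha>', \<beta>', \<nu>')"
      and \<alpha>': "\<alpha>' \<in> carrier_mat (1 + ambient P') (1 + ambient P)"
      and corner: "\<alpha>' $$ (0, 0) = of_int u * tpow n * \<alpha> $$ (0, 0) * (of_int w * tpow (- m))"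
      using act_corner[OF v_def based \<alpha> gw hu] unfolding f' by blast
    have famk: "\<exists>A B N. family p k = (free_module 1, free_module 1, A, B, N)
        \<and> A \<in> carrier_mat (1 + ambient (free_module 1)) (1 + ambient (free_module 1)) \<and> A $$ (0, 0) = family_entry p k" for k
      by (simp add: family_def Let_def bdry_aut_alpha_def mat2_index mat2_carrier flip: numeral_2_eq_2)
    obtain Al Bl Nl where l: "family p (int l + 1) = (free_module 1, free_module 1, Al, Bl, Nl)"
        "Al \<in> carrier_mat (1 + ambient (free_module 1)) (1 + ambient (free_module 1))"
        "Al $$ (0, 0) = family_entry p (int l + 1)"
      using famk[of "int l + 1"] by blast
    obtain Ak Bk Nk where k: "family p (int k + 1) = (free_module 1, free_module 1, Ak, Bk, Nk)"
        "Ak \<in> carrier_mat (1 + ambient (free_module 1)) (1 + ambient (free_module 1))"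
        "Ak $$ (0, 0) = family_entry p (int k + 1)"
      using famk[of "int k + 1"] by blast
    have "stably_homotopic ?b ?b f (family p (int l + 1))"
      using refl[of "int l + 1"] unfolding Cl[unfolded C_def] by (simp add: stable_class_def)
    then obtain z where z: "family_entry p (int l + 1) - \<alpha> $$ (0, 0) = z * (2 * of_int c)"
      using stably_homotopic_corner[OF bar_of_int \<alpha> l(2)] unfolding f' l(1) l(3)[symmetric] unfolding v_def by blast
    have "stably_homotopic ?b ?b (act v g h f) (family p (int k + 1))"
      using refl[of "int k + 1"] unfolding Ck[unfolded C_def] by (simp add: stable_class_def)
    then obtain y where y: "family_entry p (int k + 1) - \<alpha>' $$ (0, 0) = y * (2 * of_int c)"
      using stably_homotopic_corner[OF bar_of_int \<alpha>' k(2)] unfolding act k(1) k(3)[symmetric] unfolding v_def by blast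
    define q where "q = of_int (u * w) * tpow (n - m)"
    have q: "\<alpha>' $$ (0, 0) = q * \<alpha> $$ (0, 0)"
    proof -
      have "tpow (n - m) = tpow n * tpow (- m)"
        by (simp add: tpow_add)
      then show ?thesis
        unfolding corner q_def by (simp add: ac_simps)
    qed
    have "family_entry p (int k + 1) - q * family_entry p (int l + 1)
        = (family_entry p (int k + 1) - \<alpha>' $$ (0, 0)) - q * (family_entry p (int l + 1) - \<alpha> $$ (0, 0))"
      unfolding q by (simp add: algebra_simps)
    also have "\<dots> = (y - q * z) * (2 * of_int c)"
      unfolding y z by (simp add: algebra_simps)
    finally have eq: "family_entry p (int k + 1) - q * family_entry p (int l + 1)
        = (y - q * z) * (2 * of_int c)" .
    have "u * w \<in> {1, - 1}"
      using u w by auto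
    then have "int k + 1 = int l + 1"
      by (rule family_entries_inequivalent[OF assms _ _ _ eq[unfolded q_def c_def], rotated 2]) simp_all
    then show "k = l"
      by simp
  qed
  then have "infinite (range (\<lambda>k. r `` {C k}))"
    using finite_imageD infinite_UNIV_nat by blast
  then show ?thesis
    using sub finite_subset unfolding v_def c_def by blast
qed

end
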